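(* For $n\ge0$ let $J_n(q)=\sum_{|\lambda|=n}J_\lambda(q)$ ($J_0=1$). Then: (1) $J_n(q)$ is a polynomial in $q$ of degree $2\binom n2$ with nonnegative integer coefficients, it is palindromic, i.e. $J_n(q)=q^{2\binom n2}J_n(1/q)$, and $J_n(1)=n!$. (2) For $q>1$, $$\frac{J_n(q)}{q^{n^2}(1-q^{-1})^2\cdots(1-q^{-n})^2}=[u^n]\prod_{r=1}^\infty\prod_{s=0}^\infty\frac{1}{1-u/q^{r+s}}.$$
   Context: For a partition $\lambda$: $n(\lambda)=\sum_i(i-1)\lambda_i$; $h(s)$ is the hook length of box $s$. $J_\lambda(q)=\frac{q^{|\lambda|^2-|\lambda|-2n(\lambda)}\prod_{k=1}^{|\lambda|}(1-q^{-k})^2}{\prod_{s\in\lambda}(1-q^{-h(s)})^2}$. $[u^n]f(u)$ denotes the coefficient of $u^n$ in the power series $f(u)$. *)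

theory Defs
  imports Complex_Main "HOL-Computational_Algebra.Polynomial" "HOL-Computational_Algebra.Formal_Power_Series"
begin

text \<open>A partition of n: a weakly decreasing list of positive parts summing to n.
  Parts are 0-indexed: part i is lam ! i (the paper's lambda_(i+1)).\<close>
definition is_partition :: "nat \<Rightarrow> nat list \<Rightarrow> bool" where
  "is_partition n lam \<longleftrightarrow> sorted (rev lam) \<and> (\<forall>x\<in>set lam. 0 < x) \<and> sum_list lam = n"

definition partitions :: "nat \<Rightarrow> nat list set" where
  "partitions n = {lam. is_partition n lam}"

definition boxes :: "nat list \<Rightarrow> (nat \<times> nat) set" where
  "boxes lam = {(i, j). i < length lam \<and> j < lam ! i}"

definition conj_part :: "nat list \<Rightarrow> nat \<Rightarrow> nat" where
  "conj_part lam j = card {i. i < length lam \<and> j < lam ! i}"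

definition hook :: "nat list \<Rightarrow> nat \<times> nat \<Rightarrow> nat" where
  "hook lam s = (case s of (i, j) \<Rightarrow> (lam ! i - j - 1) + (conj_part lam j - i - 1) + 1)"

text \<open>n(lambda) = sum_i (i-1) lambda_i (1-indexed) = sum_i i * lam!i (0-indexed).\<close>
definition n_stat :: "nat list \<Rightarrow> nat" where
  "n_stat lam = (\<Sum>i<length lam. i * lam ! i)"

definition J_part :: "nat list \<Rightarrow> real \<Rightarrow> real" where
  "J_part lam q =
     (let m = sum_list lam in
      q powi (int m ^ 2 - int m - 2 * int (n_stat lam))
      * (\<Prod>k\<in>{1..m}. (1 - q powi (- int k)) ^ 2)
      / (\<Prod>s\<in>boxes lam. (1 - q powi (- int (hook lam s))) ^ 2))"

definition J_n :: "nat \<Rightarrow> real \<Rightarrow> real" where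
  "J_n n q = (\<Sum>lam\<in>partitions n. J_part lam q)"

definition prod_trunc :: "real \<Rightarrow> nat \<Rightarrow> real fps" where
  "prod_trunc q N = (\<Prod>r\<in>{1..N}. \<Prod>s\<in>{0..N}.
      inverse (1 - fps_const (1 / q ^ (r + s)) * fps_X))"

end

theory Submission
  imports Defs "Jordan_Normal_Form.Determinant"
begin

text \<open>
  Put \<open>t = 1/q\<close> and let \<open>H\<^sub>\<lambda> = t\<^bsup>n(\<lambda>)\<^esup> / \<Prod>(1 - t\<^bsup>h(s)\<^esup>)\<close>, the principal specialisation
  \<open>s\<^sub>\<lambda>(1, t, t\<^sup>2, \<dots>)\<close>. Then \<open>J\<^sub>n(q) = q\<^bsup>n(n-1)\<^esup> (t;t)\<^sub>n\<^sup>2 a\<^sub>n\<close> with \<open>a\<^sub>n = \<Sum> H\<^sub>\<lambda>\<^sup>2\<close>.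
  The hook formula is rewritten as the determinant of the matrix with entries \<open>1 / (t;t)\<^bsub>l\<^sub>i - j\<^esub>\<close>,
  whose rows telescope; this gives the branching rule \<open>H\<^sub>\<lambda> = \<Sum> t\<^bsup>|\<mu>|\<^esup> H\<^sub>\<mu>\<close> over all \<open>\<mu>\<close>
  interlacing with \<open>\<lambda>\<close>. A local bijection on interlacing partitions turns it into the Pieri rule,
  and the two together give \<open>A(u) = E(u) A(t u)\<close> for \<open>A(u) = \<Sum> a\<^sub>n u\<^sup>n\<close> and
  \<open>E(u) = \<Sum> u\<^sup>n / (t;t)\<^sub>n\<close>. The double product satisfies the same equation, which proves (2).
  The equation also shows \<open>a\<^sub>n(1/t) = t\<^bsup>2n\<^esup> a\<^sub>n(t)\<close>, hence palindromicity, and its limits at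
  \<open>t = 0\<close> and \<open>t = 1\<close> give the extreme coefficients and the value \<open>n!\<close>. Finally, splitting the
  branching rule according to the topmost row of the removed strip shows that \<open>(t;t)\<^sub>n H\<^sub>\<lambda>\<close>
  is a polynomial with nonnegative integer coefficients.
\<close>

section \<open>Determinants\<close>

definition qpoch :: "real \<Rightarrow> nat \<Rightarrow> real" where
  "qpoch t n = (\<Prod>k\<in>{1..n}. 1 - t ^ k)"

lemma qpoch_0 [simp]: "qpoch t 0 = 1"
  by (simp add: qpoch_def)

lemma qpoch_Suc: "qpoch t (Suc n) = qpoch t n * (1 - t ^ Suc n)"
  by (simp add: qpoch_def)

text \<open>This makes \<open>t\<close> and every \<open>1 - t ^ k\<close> with \<open>k > 0\<close>
  invertible. The condition is stable under replacing \<open>t\<close> by \<open>1 / t\<close> and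
  allows negative \<open>t\<close> and both sides of 1, so that all admissible real \<open>q\<close>
  are treated at once.\<close>

definition generic :: "real \<Rightarrow> bool" where
  "generic t \<longleftrightarrow> t \<noteq> 0 \<and> \<bar>t\<bar> \<noteq> 1"

lemma generic_power_neq_1: "generic t \<Longrightarrow> k > 0 \<Longrightarrow> t ^ k \<noteq> 1"
  by (metis abs_1 generic_def power_eq_1_iff real_norm_def less_numeral_extra(3))

lemma qpoch_nonzero: "generic t \<Longrightarrow> qpoch t n \<noteq> 0"
  using generic_power_neq_1[of t] by (auto simp: qpoch_def)

text \<open>The matrix is the Vandermonde matrix times the coefficient matrix of the
  \<open>p j\<close>, which is upper triangular with ones on the diagonal.\<close>

lemma det_monic_polys:
  fixes x :: "nat \<Rightarrow> 'a :: comm_ring_1" and p :: "nat \<Rightarrow> 'a poly"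
  assumes deg: "\<And>j. j < n \<Longrightarrow> degree (p j) = j" and monic: "\<And>j. j < n \<Longrightarrow> lead_coeff (p j) = 1"
  shows "det (mat n n (\<lambda>(i, j). poly (p j) (x i))) = det (mat n n (\<lambda>(i, j). x i ^ j))"
proof -
  let ?V = "mat n n (\<lambda>(i, j). x i ^ j)"
  let ?T = "mat n n (\<lambda>(k, j). coeff (p j) k)"
  have entry: "poly (p j) y = (\<Sum>k<n. y ^ k * coeff (p j) k)" if "j < n" for j y
  proof -
    have "poly (p j) y = (\<Sum>k\<le>j. coeff (p j) k * y ^ k)"
      using deg[OF that] by (simp add: poly_altdef)
    also have "\<dots> = (\<Sum>k<n. coeff (p j) k * y ^ k)"
      using that deg[OF that] by (intro sum.mono_neutral_left) (auto simp: coeff_eq_0)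
    finally show ?thesis by (simp add: mult.commute)
  qed
  have eq: "mat n n (\<lambda>(i, j). poly (p j) (x i)) = ?V * ?T"
    by (rule eq_matI) (auto simp: entry scalar_prod_def lessThan_atLeast0)
  have "upper_triangular ?T"
    using deg by (auto simp: upper_triangular_def intro: coeff_eq_0)
  then have "det ?T = prod_list (diag_mat ?T)"
    by (rule det_upper_triangular[where n = n]) simp
  also have "\<dots> = 1"
    unfolding prod_list_diag_prod using deg monic by (intro prod.neutral) auto
  finally show ?thesis
    unfolding eq by (subst det_mult[where n = n]) auto
qed

definition newton_poly :: "(nat \<Rightarrow> 'a :: idom) \<Rightarrow> nat \<Rightarrow> 'a poly" where
  "newton_poly c j = (\<Prod>k<j. [:- c k, 1:])"

lemma newton_poly_monic: "degree (newton_poly c j) = j" "lead_coeff (newton_poly c j) = 1"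
  unfolding newton_poly_def
  by (subst degree_prod_eq_sum_degree; simp) (simp add: lead_coeff_prod)

lemma poly_newton_poly: "poly (newton_poly c j) x = (\<Prod>k<j. x - c k)"
  by (simp add: newton_poly_def poly_prod)

text \<open>By \<open>det_monic_polys\<close> the determinant does not depend on the nodes
  \<open>c\<close>. Taking \<open>c = x\<close> makes the matrix lower triangular, so the
  Vandermonde product can be read off the diagonal.\<close>

lemma det_newton:
  fixes x c :: "nat \<Rightarrow> 'a :: idom"
  shows "det (mat n n (\<lambda>(i, j). \<Prod>k<j. x i - c k)) = (\<Prod>i<n. \<Prod>k<i. x i - x k)"
proof -
  have *: "det (mat n n (\<lambda>(i, j). \<Prod>k<j. x i - d k)) = det (mat n n (\<lambda>(i, j). x i ^ j))" for d
    using det_monic_polys[of n "newton_poly d" x] newton_poly_monic[of d]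
    by (simp add: poly_newton_poly)
  let ?L = "mat n n (\<lambda>(i, j). \<Prod>k<j. x i - x k)"
  have "det ?L = prod_list (diag_mat ?L)"
    by (rule det_lower_triangular[where n = n]) (auto intro!: prod_zero)
  also have "\<dots> = (\<Prod>i<n. \<Prod>k<i. x i - x k)"
    by (simp add: prod_list_diag_prod lessThan_atLeast0)
  finally show ?thesis using *[of c] *[of x] by simp
qed

lemma det_mat:
  "det (mat n n (\<lambda>(i, j). f i j)) =
    (\<Sum>p | p permutes {0..<n}. signof p * (\<Prod>i = 0..<n. f i (p i) :: 'a :: comm_ring_1))"
  by (subst det_def'[where n = n])
    (auto intro!: sum.cong arg_cong2[where f = "(*)"] prod.cong simp: permutes_in_image[THEN iffD2])

lemma det_scale_rows_cols:
  fixes f :: "nat \<Rightarrow> nat \<Rightarrow> 'a :: comm_ring_1"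
  shows "det (mat n n (\<lambda>(i, j). a i * b j * f i j)) =
    (\<Prod>i<n. a i) * (\<Prod>j<n. b j) * det (mat n n (\<lambda>(i, j). f i j))"
proof -
  have "(\<Prod>i = 0..<n. a i * b (p i) * f i (p i)) = (\<Prod>i<n. a i) * (\<Prod>j<n. b j) * (\<Prod>i = 0..<n. f i (p i))"
    if "p permutes {0..<n}" for p
  proof -
    have "(\<Prod>i = 0..<n. b (p i)) = (\<Prod>i = 0..<n. b i)"
      using prod.permute[OF that, of b] by (simp add: o_def)
    then show ?thesis by (simp add: prod.distrib lessThan_atLeast0)
  qed
  then show ?thesis
    by (simp add: det_mat sum_distrib_left mult_ac)
qed

text \<open>Multilinearity in the rows: a choice function \<mu> picks one summand from each
  row.\<close>

lemma det_sum_rows: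
  fixes f :: "nat \<Rightarrow> nat \<Rightarrow> nat \<Rightarrow> 'a :: comm_ring_1"
  assumes "\<And>i. i < n \<Longrightarrow> finite (S i)"
  shows "det (mat n n (\<lambda>(i, j). \<Sum>m\<in>S i. f i m j)) =
    (\<Sum>\<mu>\<in>PiE {..<n} S. det (mat n n (\<lambda>(i, j). f i (\<mu> i) j)))"
proof -
  have "(\<Prod>i = 0..<n. \<Sum>m\<in>S i. f i m (p i)) = (\<Sum>\<mu>\<in>PiE {..<n} S. \<Prod>i = 0..<n. f i (\<mu> i) (p i))" for p
    unfolding lessThan_atLeast0 using assms by (intro prod_sum_PiE) auto
  then show ?thesis
    by (simp add: det_mat sum_distrib_left) (rule sum.swap)
qed

text \<open>Subtracting from each row its successor is left multiplication by a unitriangular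
  matrix. The last row has no successor inside the matrix, whence the vanishing of
  \<open>g n\<close>.\<close>

lemma det_telescoping_rows:
  fixes g :: "nat \<Rightarrow> nat \<Rightarrow> 'a :: idom"
  assumes "\<And>j. j < n \<Longrightarrow> g n j = 0"
  shows "det (mat n n (\<lambda>(i, j). g i j - g (Suc i) j)) = det (mat n n (\<lambda>(i, j). g i j))"
proof -
  let ?U = "mat n n (\<lambda>(i, k). if k = i then 1 else if k = Suc i then - 1 else (0 :: 'a))"
  let ?G = "mat n n (\<lambda>(i, j). g i j)"
  have eq: "mat n n (\<lambda>(i, j). g i j - g (Suc i) j) = ?U * ?G"
  proof (rule eq_matI, goal_cases)
    case (1 i j)
    then have ij: "i < n" "j < n" by auto
    have "(\<Sum>k<n. (if k = i then 1 else if k = Suc i then - 1 else 0) * g k j) =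
      (\<Sum>k<n. (if k = i then g k j else 0) + (if k = Suc i then - g k j else 0))"
      by (intro sum.cong) auto
    also have "\<dots> = g i j - g (Suc i) j"
      using ij assms[of j] by (auto simp: sum.distrib not_less_eq_eq le_Suc_eq not_less)
    finally show ?case using ij by (simp add: scalar_prod_def lessThan_atLeast0)
  qed auto
  have "det ?U = prod_list (diag_mat ?U)"
    by (rule det_upper_triangular[where n = n]) (auto simp: upper_triangular_def)
  also have "\<dots> = 1"
    unfolding prod_list_diag_prod by (intro prod.neutral) auto
  finally show ?thesis
    unfolding eq by (subst det_mult[where n = n]) auto
qed

section \<open>The branching rule\<close>

definition ipart :: "(nat \<Rightarrow> nat) \<Rightarrow> bool" where
  "ipart \<alpha> \<longleftrightarrow> antimono \<alpha> \<and> finite {i. \<alpha> i \<noteq> 0}"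

definition psize :: "(nat \<Rightarrow> nat) \<Rightarrow> nat" where
  "psize \<alpha> = (\<Sum>i | \<alpha> i \<noteq> 0. \<alpha> i)"

text \<open>Equivalently, for partitions: the skew shape \<alpha>/\<mu> is a horizontal
  strip.\<close>

definition interlaces :: "(nat \<Rightarrow> nat) \<Rightarrow> (nat \<Rightarrow> nat) \<Rightarrow> bool"  (infix "\<lless>" 50) where
  "\<mu> \<lless> \<alpha> \<longleftrightarrow> (\<forall>i. \<alpha> (Suc i) \<le> \<mu> i \<and> \<mu> i \<le> \<alpha> i)"

lemma psize_eq: "(\<And>i. i \<ge> N \<Longrightarrow> \<alpha> i = 0) \<Longrightarrow> psize \<alpha> = (\<Sum>i<N. \<alpha> i)"
  unfolding psize_def by (rule sum.mono_neutral_left) (auto, metis not_le less_irrefl)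

lemma ipart_bound:
  assumes "ipart \<alpha>"
  obtains N where "\<forall>i\<ge>N. \<alpha> i = 0"
proof -
  obtain N where "{i. \<alpha> i \<noteq> 0} \<subseteq> {..<N}"
    using assms finite_nat_iff_bounded[of "{i. \<alpha> i \<noteq> 0}"] by (auto simp: ipart_def)
  then have "\<alpha> i = 0" if "i \<ge> N" for i
    using that by (metis (mono_tags, lifting) lessThan_iff mem_Collect_eq not_le subsetD)
  then show ?thesis using that by blast
qed

lemma ipart_antimono: "ipart \<alpha> \<Longrightarrow> i \<le> j \<Longrightarrow> \<alpha> j \<le> \<alpha> i"
  by (auto simp: ipart_def antimono_def)

lemma ipartI:
  assumes "\<And>i. \<alpha> (Suc i) \<le> \<alpha> i" "\<And>i. i \<ge> N \<Longrightarrow> \<alpha> i = 0"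
  shows "ipart \<alpha>"
proof -
  have "{i. \<alpha> i \<noteq> 0} \<subseteq> {..<N}" using assms(2) by (auto, metis not_le less_irrefl)
  then show ?thesis
    using assms(1) finite_subset by (auto simp: ipart_def antimono_iff_le_Suc)
qed

lemma interlaces_ipart_lower:
  assumes "\<mu> \<lless> \<alpha>" "ipart \<alpha>" shows "ipart \<mu>"
proof -
  obtain N where "\<forall>i\<ge>N. \<alpha> i = 0" using assms(2) by (rule ipart_bound)
  then have N: "\<And>i. i \<ge> N \<Longrightarrow> \<alpha> i = 0" by blast
  show ?thesis
  proof (rule ipartI)
    show "\<mu> (Suc i) \<le> \<mu> i" for i
      using assms(1) unfolding interlaces_def by (meson le_trans)
    show "\<mu> i = 0" if "i \<ge> N" for i
      using assms(1) N[OF that] unfolding interlaces_def by (metis le_zero_eq)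
  qed
qed

lemma interlaces_ipart_upper:
  assumes "\<mu> \<lless> \<alpha>" "ipart \<mu>" shows "ipart \<alpha>"
proof -
  obtain N where "\<forall>i\<ge>N. \<mu> i = 0" using assms(2) by (rule ipart_bound)
  then have N: "\<And>i. i \<ge> N \<Longrightarrow> \<mu> i = 0" by blast
  \<comment> \<open>The upper partition may have one nonzero part more than the lower one.\<close>
  have "\<alpha> i = 0" if "i \<ge> Suc N" for i
    using assms(1) N[of "i - 1"] that unfolding interlaces_def
    by (metis Suc_diff_1 Suc_le_D le_zero_eq diff_Suc_1 Suc_le_mono zero_less_Suc)
  then show ?thesis
    using assms(1) by (intro ipartI[where N = "Suc N"]) (auto simp: interlaces_def intro: le_trans)
qed

lemma finite_interlaces_lower:
  assumes "ipart \<alpha>" shows "finite {\<mu>. \<mu> \<lless> \<alpha>}"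
proof -
  obtain N where "\<forall>i\<ge>N. \<alpha> i = 0" using assms by (rule ipart_bound)
  then have N: "\<And>i. i \<ge> N \<Longrightarrow> \<alpha> i = 0" by blast
  have "{\<mu>. \<mu> \<lless> \<alpha>} \<subseteq> {\<mu>. \<forall>i. (i \<in> {..<N} \<longrightarrow> \<mu> i \<in> {..\<alpha> 0}) \<and> (i \<notin> {..<N} \<longrightarrow> \<mu> i = 0)}"
    using N ipart_antimono[OF assms, of 0]
    by (auto simp: interlaces_def intro: le_trans) (metis le_zero_eq not_less)
  then show ?thesis
    by (rule finite_subset) (intro finite_set_of_finite_funs, auto)
qed

text \<open>The hook formula in terms of the strictly decreasing numbers
  \<open>l_i = \<alpha> i + (N - 1 - i)\<close>: for weakly decreasing \<alpha> the numerator
  exponents are the differences \<open>l_i - l_j\<close>, and the denominators are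
  \<open>(t;t)_{l_i}\<close>. Here \<open>N\<close> may exceed the number of nonzero parts.\<close>

definition schur_rows :: "real \<Rightarrow> nat \<Rightarrow> (nat \<Rightarrow> nat) \<Rightarrow> real" where
  "schur_rows t N \<alpha> = t ^ (\<Sum>i<N. i * \<alpha> i) * (\<Prod>j<N. \<Prod>i<j. 1 - t ^ (\<alpha> i - \<alpha> j + (j - i)))
     / (\<Prod>i<N. qpoch t (\<alpha> i + (N - 1 - i)))"

lemma schur_rows_cong:
  assumes "\<And>i. i < N \<Longrightarrow> \<alpha> i = \<beta> i"
  shows "schur_rows t N \<alpha> = schur_rows t N \<beta>"
  using assms
  by (auto simp: schur_rows_def intro!: arg_cong2[where f = "(/)"] arg_cong2[where f = "(*)"] prod.cong)

text \<open>An extra zero row contributes the factors \<open>1 - t ^ (\<alpha> i + (N - i))\<close>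
  to the numerator through the new differences, and the same factors to the denominator because
  every \<open>l_i\<close> grows by one.\<close>

lemma schur_rows_Suc:
  assumes "generic t" "\<alpha> N = 0"
  shows "schur_rows t (Suc N) \<alpha> = schur_rows t N \<alpha>"
proof -
  let ?c = "\<Prod>i<N. 1 - t ^ (\<alpha> i + (N - i))"
  have "(\<Prod>i<N. qpoch t (\<alpha> i + (N - i))) = (\<Prod>i<N. qpoch t (\<alpha> i + (N - 1 - i)) * (1 - t ^ (\<alpha> i + (N - i))))"
  proof (rule prod.cong, goal_cases)
    case (2 i)
    then have "\<alpha> i + (N - i) = Suc (\<alpha> i + (N - 1 - i))" by simp
    then show ?case by (simp only: qpoch_Suc)
  qed simp
  then have den: "(\<Prod>i<Suc N. qpoch t (\<alpha> i + (N - i))) = (\<Prod>i<N. qpoch t (\<alpha> i + (N - 1 - i))) * ?c"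
    using assms by (simp add: prod.distrib)
  have "?c \<noteq> 0" using generic_power_neq_1[OF assms(1)] by auto
  then show ?thesis
    using assms den by (simp add: schur_rows_def)
qed

text \<open>The principal specialisation \<open>s\<^sub>\<lambda>(1, t, t\<^sup>2, \<dots>)\<close> of the Schur function.\<close>

definition schur :: "real \<Rightarrow> (nat \<Rightarrow> nat) \<Rightarrow> real" where
  "schur t \<alpha> = schur_rows t (LEAST N. \<forall>i\<ge>N. \<alpha> i = 0) \<alpha>"

lemma schur_eq_schur_rows:
  assumes t: "generic t" and N: "\<And>i. i \<ge> N \<Longrightarrow> \<alpha> i = 0"
  shows "schur t \<alpha> = schur_rows t N \<alpha>"
proof -
  define L where "L = (LEAST N. \<forall>i\<ge>N. \<alpha> i = 0)"
  have L: "\<forall>i\<ge>L. \<alpha> i = 0" unfolding L_def by (rule LeastI[of _ N]) (use N in auto)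
  have "L \<le> N" unfolding L_def by (rule Least_le) (use N in auto)
  then have "schur_rows t N \<alpha> = schur_rows t L \<alpha>"
    by (induction rule: dec_induct) (use L t in \<open>auto simp: schur_rows_Suc\<close>)
  then show ?thesis by (simp add: schur_def L_def)
qed

text \<open>The complete symmetric function \<open>h\<^bsub>m-j\<^esub>(1, t, t\<^sup>2, \<dots>)\<close>.\<close>

definition inv_qpoch :: "real \<Rightarrow> nat \<Rightarrow> nat \<Rightarrow> real" where
  "inv_qpoch t j m = (if m < j then 0 else 1 / qpoch t (m - j))"

text \<open>Up to a row factor and a column factor the entry is a Newton product in the variable
  \<open>t ^ m\<close> with nodes \<open>t ^ k\<close>, the form that \<open>det_newton\<close>
  evaluates. The convention 0 for \<open>m < j\<close> fits, since the factor with
  \<open>k = m\<close> vanishes.\<close>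

lemma inv_qpoch_eq:
  assumes "generic t"
  shows "inv_qpoch t j m = 1 / qpoch t m * (\<Prod>k<j. - (1 / t ^ k)) * (\<Prod>k<j. t ^ m - t ^ k)"
proof (induction j)
  case 0
  then show ?case by (simp add: inv_qpoch_def)
next
  case (Suc j)
  have t: "t \<noteq> 0" using assms by (simp add: generic_def)
  have "inv_qpoch t (Suc j) m = inv_qpoch t j m * (- (1 / t ^ j) * (t ^ m - t ^ j))"
  proof (cases "j < m")
    case True
    then obtain d where d: "m = Suc (j + d)" using less_iff_Suc_add by auto
    have "1 - t ^ Suc d \<noteq> 0" using generic_power_neq_1[OF assms, of "Suc d"] by simp
    moreover have "- (1 / t ^ j) * (t ^ m - t ^ j) = 1 - t ^ Suc d"
      using t by (simp add: d field_simps power_add)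
    ultimately show ?thesis
      using qpoch_nonzero[OF assms, of d] by (simp add: inv_qpoch_def d qpoch_Suc del: power_Suc)
  qed (auto simp: inv_qpoch_def)
  then show ?case using Suc by (simp add: mult_ac)
qed

text \<open>Each step is \<open>1/(t;t)_d + t^(d+1)/(t;t)_(d+1) = 1/(t;t)_(d+1)\<close>. The empty
  sum is separate because \<open>L - 1\<close> truncates at 0, where the entry for
  \<open>j = 0\<close> is 1.\<close>

lemma sum_inv_qpoch:
  assumes "generic t"
  shows "(\<Sum>m<L. t ^ m * inv_qpoch t j m) = (if L = 0 then 0 else t ^ j * inv_qpoch t j (L - 1))"
proof (induction L)
  case (Suc L)
  consider "L < j" | "L = j" | d where "L = Suc (j + d)"
    using less_iff_Suc_add linorder_neqE_nat by metis
  then show ?case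
  proof cases
    case 3
    have "1 - t ^ Suc d \<noteq> 0" using generic_power_neq_1[OF assms, of "Suc d"] by simp
    then show ?thesis
      using Suc qpoch_nonzero[OF assms, of d]
      by (simp add: inv_qpoch_def 3 qpoch_Suc field_simps power_add)
  qed (use Suc in \<open>auto simp: inv_qpoch_def\<close>)
qed simp

text \<open>Both sides are \<open>N choose 3\<close>. The identity cancels the stray powers of
  \<open>t\<close> in \<open>det_inv_qpoch\<close>.\<close>

lemma sum_mult_complement: "(\<Sum>i<N. i * (N - 1 - i)) = (\<Sum>i<N. \<Sum>k<i. k :: nat)"
proof (induction N)
  case (Suc N)
  have "(\<Sum>i<Suc N. i * (Suc N - 1 - i)) = (\<Sum>i<N. i * (N - 1 - i) + i)"
  proof -
    have "i * (Suc N - 1 - i) = i * (N - 1 - i) + i" if "i < N" for i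
      using that by (cases "N - i") (auto simp: Suc_diff_Suc)
    then show ?thesis by simp
  qed
  then show ?case using Suc by (simp add: sum.distrib)
qed simp

text \<open>This is the Jacobi-Trudi determinant with its columns in reverse order, which accounts
  for the sign. Row and column factors are pulled out and the remaining Newton determinant is a
  Vandermonde product.\<close>

lemma det_inv_qpoch:
  assumes t: "generic t" and anti: "\<And>i j. i \<le> j \<Longrightarrow> \<alpha> j \<le> \<alpha> i"
  shows "det (mat N N (\<lambda>(i, j). inv_qpoch t j (\<alpha> i + (N - 1 - i)))) =
    (\<Prod>i<N. (- 1) ^ i) * schur_rows t N \<alpha>"
proof -
  define l where "l i = \<alpha> i + (N - 1 - i)" for i
  have t0: "t \<noteq> 0" using t by (simp add: generic_def)
  have "det (mat N N (\<lambda>(i, j). inv_qpoch t j (l i))) =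
    (\<Prod>i<N. 1 / qpoch t (l i)) * ((\<Prod>i<N. \<Prod>k<i. - (1 / t ^ k)) * (\<Prod>i<N. \<Prod>k<i. t ^ l i - t ^ l k))"
    unfolding inv_qpoch_eq[OF t] det_scale_rows_cols det_newton by (simp only: mult.assoc)
  \<comment> \<open>For \<open>k < i\<close> the larger power is split off:
    \<open>t^l_i - t^l_k = t^l_i (1 - t^(l_k - l_i))\<close>, and \<open>t^l_i\<close> separates
    into its \<alpha>-part and its staircase part.\<close>
  also have "(\<Prod>i<N. \<Prod>k<i. - (1 / t ^ k)) * (\<Prod>i<N. \<Prod>k<i. t ^ l i - t ^ l k) =
    (\<Prod>i<N. \<Prod>k<i. (- 1) * t ^ (\<alpha> i) * t ^ (N - 1 - i) / t ^ k * (1 - t ^ (\<alpha> k - \<alpha> i + (i - k))))"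
    unfolding prod.distrib[symmetric]
  proof (intro prod.cong refl, goal_cases)
    case (1 i k)
    then have "l k = l i + (\<alpha> k - \<alpha> i + (i - k))"
      using anti[of k i] by (auto simp: l_def)
    then have "t ^ l k = t ^ l i * t ^ (\<alpha> k - \<alpha> i + (i - k))" by (simp add: power_add)
    then show ?case
      using t0 by (simp add: l_def power_add field_simps)
  qed
  also have "\<dots> = (\<Prod>i<N. \<Prod>k<i. - 1) * (\<Prod>i<N. \<Prod>k<i. t ^ \<alpha> i)
      * ((\<Prod>i<N. \<Prod>k<i. t ^ (N - 1 - i)) / (\<Prod>i<N. \<Prod>k<i. t ^ k))
      * (\<Prod>i<N. \<Prod>k<i. 1 - t ^ (\<alpha> k - \<alpha> i + (i - k)))"
    by (simp only: prod.distrib prod_dividef times_divide_eq_right times_divide_eq_left)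
  also have "(\<Prod>i<N. \<Prod>k<i. t ^ (N - 1 - i)) = t ^ (\<Sum>i<N. i * (N - 1 - i))"
    by (simp add: power_sum power_mult[symmetric] mult.commute)
  also have "\<dots> = (\<Prod>i<N. \<Prod>k<i. t ^ k)"
    unfolding sum_mult_complement by (simp add: power_sum)
  also have "(\<Prod>i<N. \<Prod>k<i. t ^ \<alpha> i) = t ^ (\<Sum>i<N. i * \<alpha> i)"
    by (simp add: power_sum power_mult[symmetric] mult.commute)
  finally show ?thesis
    using t0 by (simp add: schur_rows_def l_def prod_dividef)
qed

lemma sum_shifted_interval:
  fixes f :: "nat \<Rightarrow> 'a :: ab_group_add"
  assumes "a \<le> Suc b"
  shows "(\<Sum>m\<in>{a..b}. f (m + c)) = (\<Sum>m<b + Suc c. f m) - (\<Sum>m<a + c. f m)"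
proof -
  have "(\<Sum>m\<in>{a..b}. f (m + c)) = (\<Sum>m\<in>{a + c..b + c}. f m)"
    by (rule sum.shift_bounds_cl_nat_ivl[symmetric])
  moreover have "{..<b + Suc c} = {..<a + c} \<union> {a + c..b + c}" using assms by auto
  ultimately show ?thesis by (simp add: sum.union_disjoint ivl_disj_int)
qed

text \<open>By multilinearity the right-hand side, times sign and staircase powers, is a determinant
  of row sums. Each row sum runs over an interval and is a difference of consecutive partial sums,
  so the rows telescope, and by \<open>sum_inv_qpoch\<close> the partial sums are the original
  entries up to column factors.\<close>

lemma schur_rows_branching:
  assumes t: "generic t" and anti: "\<And>i j. i \<le> j \<Longrightarrow> \<alpha> j \<le> \<alpha> i" and N: "\<alpha> N = 0"
  shows "schur_rows t N \<alpha> =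
    (\<Sum>\<mu>\<in>PiE {..<N} (\<lambda>i. {\<alpha> (Suc i)..\<alpha> i}). t ^ (\<Sum>i<N. \<mu> i) * schur_rows t N \<mu>)"
proof -
  define D where "D \<mu> = det (mat N N (\<lambda>(i, j). inv_qpoch t j (\<mu> i + (N - 1 - i))))" for \<mu> :: "nat \<Rightarrow> nat"
  \<comment> \<open>The range stops just after \<open>l_i\<close>. For \<open>i = N\<close> it is
    empty because \<open>\<alpha> N = 0\<close>, which is the boundary condition of the
    telescoping.\<close>
  define S where "S i j = (\<Sum>m<\<alpha> i + (N - i). t ^ m * inv_qpoch t j m)" for i j
  define P where "P = PiE {..<N} (\<lambda>i. {\<alpha> (Suc i)..\<alpha> i})"
  have t0: "t \<noteq> 0" using t by (simp add: generic_def)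
  have S: "S i j = t ^ j * inv_qpoch t j (\<alpha> i + (N - 1 - i))" if "i < N" for i j
    using that by (simp add: S_def sum_inv_qpoch[OF t])
  have row: "(\<Sum>m\<in>{\<alpha> (Suc i)..\<alpha> i}. t ^ (m + (N - 1 - i)) * inv_qpoch t j (m + (N - 1 - i))) =
      S i j - S (Suc i) j" if "i < N" for i j
  proof -
    have eq: "Suc (N - 1 - i) = N - i" "N - Suc i = N - 1 - i" using that by auto
    have "\<alpha> (Suc i) \<le> Suc (\<alpha> i)" using anti[of i "Suc i"] by simp
    from sum_shifted_interval[OF this, of "\<lambda>m. t ^ m * inv_qpoch t j m" "N - 1 - i"]
    show ?thesis unfolding S_def eq .
  qed
  have "(\<Sum>\<mu>\<in>P. det (mat N N (\<lambda>(i, j). t ^ (\<mu> i + (N - 1 - i)) * inv_qpoch t j (\<mu> i + (N - 1 - i))))) =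
      det (mat N N (\<lambda>(i, j). S i j - S (Suc i) j))"
    unfolding P_def
    by (subst det_sum_rows[symmetric], simp)
      (intro arg_cong[where f = det] cong_mat refl; simp only: prod.case row)
  also have "\<dots> = det (mat N N (\<lambda>(i, j). S i j))"
    by (rule det_telescoping_rows) (simp add: S_def N)
  also have "\<dots> = det (mat N N (\<lambda>(i, j). 1 * t ^ j * inv_qpoch t j (\<alpha> i + (N - 1 - i))))"
    by (auto intro!: arg_cong[where f = det] cong_mat simp: S)
  also have "\<dots> = (\<Prod>j<N. t ^ j) * D \<alpha>"
    unfolding det_scale_rows_cols by (simp add: D_def)
  finally have 1: "(\<Sum>\<mu>\<in>P. det (mat N N (\<lambda>(i, j). t ^ (\<mu> i + (N - 1 - i)) * inv_qpoch t j (\<mu> i + (N - 1 - i))))) = \<dots>" .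
  \<comment> \<open>The staircase powers taken out of the rows are those taken out of the columns,
    so they cancel in the comparison.\<close>
  have rev: "(\<Prod>i<N. t ^ (N - 1 - i)) = (\<Prod>j<N. t ^ j)"
    using prod.nat_diff_reindex[of "\<lambda>j. t ^ j" N] by simp
  have 2: "det (mat N N (\<lambda>(i, j). t ^ (\<mu> i + (N - 1 - i)) * inv_qpoch t j (\<mu> i + (N - 1 - i)))) =
      (\<Prod>j<N. t ^ j) * (t ^ (\<Sum>i<N. \<mu> i) * D \<mu>)" for \<mu>
  proof -
    have "(\<Prod>i<N. t ^ (\<mu> i + (N - 1 - i))) = (\<Prod>j<N. t ^ j) * t ^ (\<Sum>i<N. \<mu> i)"
      unfolding power_add prod.distrib rev power_sum by (rule mult.commute)
    then show ?thesis
      using det_scale_rows_cols[of N "\<lambda>i. t ^ (\<mu> i + (N - 1 - i))" "\<lambda>_. 1" "\<lambda>i j. inv_qpoch t j (\<mu> i + (N - 1 - i))"]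
      unfolding D_def mult_1_right prod.neutral_const by (simp only: mult.assoc)
  qed
  have D: "D \<alpha> = (\<Sum>\<mu>\<in>P. t ^ (\<Sum>i<N. \<mu> i) * D \<mu>)"
    using 1 t0 unfolding 2 sum_distrib_left[symmetric] by simp
  define e :: real where "e = (\<Prod>i<N. (- 1) ^ i)"
  have e: "e \<noteq> 0" by (simp add: e_def)
  have D\<mu>: "D \<mu> = e * schur_rows t N \<mu>" if "\<mu> \<in> P" for \<mu>
  proof -
    \<comment> \<open>A choice function is \<open>undefined\<close> outside \<open>{..<N}\<close>;
      extending it by zero instead makes it decreasing everywhere, as \<open>det_inv_qpoch\<close>
      requires.\<close>
    define \<mu>' where "\<mu>' i = (if i < N then \<mu> i else 0)" for i
    have bd: "i < N \<Longrightarrow> \<alpha> (Suc i) \<le> \<mu> i \<and> \<mu> i \<le> \<alpha> i" for i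
      using that by (auto simp: P_def PiE_def Pi_def)
    have "\<mu>' (Suc i) \<le> \<mu>' i" for i
      using bd[of i] bd[of "Suc i"] by (auto simp: \<mu>'_def)
    then have "D \<mu>' = e * schur_rows t N \<mu>'"
      unfolding D_def e_def by (intro det_inv_qpoch[OF t]) (rule lift_Suc_antimono_le)
    moreover have "D \<mu>' = D \<mu>"
      by (auto simp: D_def \<mu>'_def intro!: arg_cong[where f = det] cong_mat)
    moreover have "schur_rows t N \<mu>' = schur_rows t N \<mu>"
      by (rule schur_rows_cong) (simp add: \<mu>'_def)
    ultimately show ?thesis by simp
  qed
  have "e * schur_rows t N \<alpha> = e * (\<Sum>\<mu>\<in>P. t ^ (\<Sum>i<N. \<mu> i) * schur_rows t N \<mu>)"
    using D det_inv_qpoch[OF t, of \<alpha> N, OF anti] D\<mu> by (simp add: D_def[of \<alpha>] e_def[symmetric] sum_distrib_left mult_ac)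
  then show ?thesis using e by (simp add: P_def)
qed

lemma schur_branching:
  assumes t: "generic t" and "ipart \<alpha>"
  shows "schur t \<alpha> = (\<Sum>\<mu> | \<mu> \<lless> \<alpha>. t ^ psize \<mu> * schur t \<mu>)"
proof -
  obtain N where "\<forall>i\<ge>N. \<alpha> i = 0" using assms(2) by (rule ipart_bound)
  then have N: "\<And>i. i \<ge> N \<Longrightarrow> \<alpha> i = 0" by blast
  have "schur t \<alpha> = (\<Sum>\<mu>\<in>PiE {..<N} (\<lambda>i. {\<alpha> (Suc i)..\<alpha> i}). t ^ (\<Sum>i<N. \<mu> i) * schur_rows t N \<mu>)"
    using schur_rows_branching[OF t, of \<alpha> N] ipart_antimono[OF assms(2)] N schur_eq_schur_rows[OF t N] by simp
  also have "\<dots> = (\<Sum>\<mu> | \<mu> \<lless> \<alpha>. t ^ psize \<mu> * schur t \<mu>)"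
  proof (rule sum.reindex_bij_witness[where i = "\<lambda>\<mu>. restrict \<mu> {..<N}" and j = "\<lambda>\<mu> i. if i < N then \<mu> i else 0"], goal_cases)
    case (1 \<mu>)
    then show ?case by (auto simp: PiE_def extensional_def fun_eq_iff)
  next
    case (2 \<mu>)
    then show ?case using N by (auto simp: PiE_def Pi_def interlaces_def)
  next
    case (3 \<mu>)
    then show ?case using N by (auto simp: interlaces_def fun_eq_iff) (metis le_zero_eq not_less)
  next
    case (4 \<mu>)
    then show ?case by (auto simp: interlaces_def)
  next
    case (5 \<mu>)
    let ?\<mu>' = "\<lambda>i. if i < N then \<mu> i else 0"
    have "psize ?\<mu>' = (\<Sum>i<N. \<mu> i)" by (subst psize_eq[of N]) auto
    moreover have "schur t ?\<mu>' = schur_rows t N ?\<mu>'" by (rule schur_eq_schur_rows[OF t]) auto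
    moreover have "schur_rows t N ?\<mu>' = schur_rows t N \<mu>"
      by (rule schur_rows_cong) simp
    ultimately show ?case by simp
  qed
  finally show ?thesis .
qed

section \<open>The Pieri rule and the Cauchy recurrence\<close>

definition Par :: "nat \<Rightarrow> (nat \<Rightarrow> nat) set" where
  "Par n = {\<alpha>. ipart \<alpha> \<and> psize \<alpha> = n}"

lemma ipart_eq_0:
  assumes "ipart \<alpha>" "i \<ge> psize \<alpha>" shows "\<alpha> i = 0"
proof (rule ccontr)
  assume "\<alpha> i \<noteq> 0"
  obtain N where N: "\<forall>i\<ge>N. \<alpha> i = 0" using assms(1) by (rule ipart_bound)
  have "(\<Sum>j<Suc i. 1) \<le> (\<Sum>j<Suc i. \<alpha> j)"
  proof (rule sum_mono)
    fix j assume "j \<in> {..<Suc i}"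
    then show "1 \<le> \<alpha> j" using ipart_antimono[OF assms(1), of j i] \<open>\<alpha> i \<noteq> 0\<close> by simp
  qed
  also have "\<dots> \<le> (\<Sum>j<max N (Suc i). \<alpha> j)" by (rule sum_mono2) auto
  also have "\<dots> = psize \<alpha>" using N by (intro psize_eq[symmetric]) auto
  finally show False using assms(2) by simp
qed

lemma finite_Par: "finite (Par n)"
proof -
  have "\<alpha> i \<le> n" if "\<alpha> \<in> Par n" for \<alpha> i
  proof (cases "\<alpha> i = 0")
    case False
    then have "\<alpha> i \<le> psize \<alpha>"
      using that by (auto simp: psize_def Par_def ipart_def intro: member_le_sum)
    then show ?thesis using that by (simp add: Par_def)
  qed simp
  then have "Par n \<subseteq> {\<alpha>. \<forall>i. (i \<in> {..<n} \<longrightarrow> \<alpha> i \<in> {..n}) \<and> (i \<notin> {..<n} \<longrightarrow> \<alpha> i = 0)}"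
    using ipart_eq_0 by (auto simp: Par_def)
  then show ?thesis
    by (rule finite_subset) (intro finite_set_of_finite_funs, auto)
qed

lemma finite_interlaces_upper:
  assumes "ipart \<rho>" shows "finite {\<mu>. \<rho> \<lless> \<mu> \<and> psize \<mu> = n}"
  using finite_Par[of n]
  by (rule finite_subset[rotated]) (auto simp: Par_def intro: interlaces_ipart_upper[OF _ assms])

lemma psize_interlaces:
  assumes "\<mu> \<lless> \<alpha>" "ipart \<alpha>"
  shows psize_interlaces_le: "psize \<mu> \<le> psize \<alpha>"
    and psize_interlaces_eq: "psize \<mu> = psize \<alpha> \<Longrightarrow> \<mu> = \<alpha>"
proof -
  obtain N where N: "\<forall>i\<ge>N. \<alpha> i = 0" using assms(2) by (rule ipart_bound)
  have le: "\<mu> i \<le> \<alpha> i" for i using assms(1) by (simp add: interlaces_def)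
  have N': "\<mu> i = 0" if "i \<ge> N" for i using le[of i] N that by simp
  have eq: "psize \<alpha> = (\<Sum>i<N. \<alpha> i)" "psize \<mu> = (\<Sum>i<N. \<mu> i)"
    using N N' by (auto intro!: psize_eq)
  show "psize \<mu> \<le> psize \<alpha>" unfolding eq by (rule sum_mono) (rule le)
  assume "psize \<mu> = psize \<alpha>"
  then have "\<mu> i = \<alpha> i" if "i < N" for i
    using sum_mono_inv[of \<mu> "{..<N}" \<alpha> i] le eq that by auto
  then show "\<mu> = \<alpha>" using N N' by (metis ext not_le)
qed

lemma interlaces_refl: "ipart \<alpha> \<Longrightarrow> \<alpha> \<lless> \<alpha>"
  by (auto simp: interlaces_def intro: ipart_antimono)

text \<open>Sum the hypothesis over \<open>i\<close> and use that max plus min is the sum. The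
  maxima and the parts of \<mu> enter shifted by one, so their top terms are missing and appear as
  the corrections.\<close>

lemma psize_exchange:
  assumes ip: "ipart \<rho>" "ipart \<kappa>" "ipart \<mu>" "ipart \<sigma>"
    and eq: "\<And>i. \<sigma> i + \<mu> (Suc i) = max (\<rho> (Suc i)) (\<kappa> (Suc i)) + min (\<rho> i) (\<kappa> i)"
  shows "psize \<sigma> + psize \<mu> + max (\<rho> 0) (\<kappa> 0) = psize \<rho> + psize \<kappa> + \<mu> 0"
proof -
  obtain N1 where "\<forall>i\<ge>N1. \<rho> i = 0" using ip(1) by (rule ipart_bound)
  moreover obtain N2 where "\<forall>i\<ge>N2. \<kappa> i = 0" using ip(2) by (rule ipart_bound)
  moreover obtain N3 where "\<forall>i\<ge>N3. \<mu> i = 0" using ip(3) by (rule ipart_bound)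
  moreover obtain N4 where "\<forall>i\<ge>N4. \<sigma> i = 0" using ip(4) by (rule ipart_bound)
  moreover define N where "N = N1 + N2 + N3 + N4"
  ultimately have z: "i \<ge> N \<Longrightarrow> \<rho> i = 0 \<and> \<kappa> i = 0 \<and> \<mu> i = 0 \<and> \<sigma> i = 0" for i by auto
  have "(\<Sum>i<N. \<sigma> i) + (\<Sum>i<N. \<mu> (Suc i)) =
      (\<Sum>i<N. max (\<rho> (Suc i)) (\<kappa> (Suc i))) + (\<Sum>i<N. min (\<rho> i) (\<kappa> i))"
    by (simp add: sum.distrib[symmetric] eq)
  moreover have "psize \<sigma> = (\<Sum>i<N. \<sigma> i)" by (rule psize_eq) (use z in auto)
  moreover have "psize \<mu> = \<mu> 0 + (\<Sum>i<N. \<mu> (Suc i))"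
    unfolding sum.lessThan_Suc_shift[symmetric] by (rule psize_eq) (use z in auto)
  moreover have "psize \<rho> + psize \<kappa> = (\<Sum>i<Suc N. max (\<rho> i) (\<kappa> i)) + (\<Sum>i<Suc N. min (\<rho> i) (\<kappa> i))"
  proof -
    have "psize \<rho> = (\<Sum>i<Suc N. \<rho> i)" "psize \<kappa> = (\<Sum>i<Suc N. \<kappa> i)"
      using z by (auto intro!: psize_eq)
    moreover have "\<rho> i + \<kappa> i = max (\<rho> i) (\<kappa> i) + min (\<rho> i) (\<kappa> i)" for i by linarith
    ultimately show ?thesis by (simp only: sum.distrib[symmetric])
  qed
  moreover have "(\<Sum>i<Suc N. max (\<rho> i) (\<kappa> i)) = max (\<rho> 0) (\<kappa> 0) + (\<Sum>i<N. max (\<rho> (Suc i)) (\<kappa> (Suc i)))"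
    by (rule sum.lessThan_Suc_shift)
  moreover have "(\<Sum>i<Suc N. min (\<rho> i) (\<kappa> i)) = (\<Sum>i<N. min (\<rho> i) (\<kappa> i))"
    using z[of N] by simp
  ultimately show ?thesis by linarith
qed

text \<open>For fixed \<open>\<rho>\<close> and \<open>\<kappa>\<close>, each part \<open>\<mu> (Suc i)\<close> of a common upper neighbour ranges over the
  same interval as the part \<open>\<sigma> i\<close> of a common lower neighbour, while \<open>\<mu> 0\<close> is only bounded below.
  Reflecting all these intervals exchanges upper and lower neighbours.\<close>

lemma interlaces_exchange:
  fixes f :: "(nat \<Rightarrow> nat) \<Rightarrow> 'a :: comm_monoid_add"
  assumes ip: "ipart \<rho>"
  shows "(\<Sum>\<mu> | \<rho> \<lless> \<mu> \<and> psize \<mu> = psize \<rho> + m. \<Sum>\<kappa> | \<kappa> \<lless> \<mu>. f \<kappa>) =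
    (\<Sum>\<sigma> | \<sigma> \<lless> \<rho>. \<Sum>\<kappa> | \<sigma> \<lless> \<kappa> \<and> psize \<kappa> \<le> psize \<sigma> + m. f \<kappa>)"
proof -
  define A where "A = (SIGMA \<mu>:{\<mu>. \<rho> \<lless> \<mu> \<and> psize \<mu> = psize \<rho> + m}. {\<kappa>. \<kappa> \<lless> \<mu>})"
  define B where "B = (SIGMA \<sigma>:{\<sigma>. \<sigma> \<lless> \<rho>}. {\<kappa>. \<sigma> \<lless> \<kappa> \<and> psize \<kappa> \<le> psize \<sigma> + m})"
  define lo hi where "lo \<kappa> i = max (\<rho> i) (\<kappa> i)" and "hi \<kappa> i = min (\<rho> i) (\<kappa> i)" for \<kappa> i
  define down where "down \<kappa> \<mu> i = lo \<kappa> (Suc i) + hi \<kappa> i - \<mu> (Suc i)" for \<kappa> \<mu> :: "nat \<Rightarrow> nat" and i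
  \<comment> \<open>The unbounded top part absorbs the remaining boxes. On \<open>B\<close> the
    subtraction does not truncate, since \<open>psize \<kappa> \<le> psize \<sigma> + m\<close>
    there.\<close>
  define up where "up \<kappa> \<sigma> i = (case i of 0 \<Rightarrow> lo \<kappa> 0 + (psize \<sigma> + m - psize \<kappa>)
      | Suc i \<Rightarrow> lo \<kappa> (Suc i) + hi \<kappa> i - \<sigma> i)" for \<kappa> \<sigma> i
  have finB: "finite {\<kappa>. \<sigma> \<lless> \<kappa> \<and> psize \<kappa> \<le> psize \<sigma> + m}" if "\<sigma> \<lless> \<rho>" for \<sigma>
  proof -
    have "{\<kappa>. \<sigma> \<lless> \<kappa> \<and> psize \<kappa> \<le> psize \<sigma> + m} = (\<Union>n\<le>psize \<sigma> + m. {\<kappa>. \<sigma> \<lless> \<kappa> \<and> psize \<kappa> = n})" by auto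
    then show ?thesis using finite_interlaces_upper[OF interlaces_ipart_lower[OF that ip]] by simp
  qed
  have A: "ipart \<mu>" "ipart \<kappa>" "ipart (down \<kappa> \<mu>)" "down \<kappa> \<mu> \<lless> \<rho>" "down \<kappa> \<mu> \<lless> \<kappa>"
    "\<And>i. down \<kappa> \<mu> i + \<mu> (Suc i) = lo \<kappa> (Suc i) + hi \<kappa> i" "lo \<kappa> 0 \<le> \<mu> 0"
    "psize (down \<kappa> \<mu>) + m = psize \<kappa> + (\<mu> 0 - lo \<kappa> 0)"
    if "(\<mu>, \<kappa>) \<in> A" for \<mu> \<kappa>
  proof -
    have *: "\<rho> \<lless> \<mu>" "\<kappa> \<lless> \<mu>" "psize \<mu> = psize \<rho> + m" using that by (auto simp: A_def)
    show 1: "ipart \<mu>" using *(1) ip by (rule interlaces_ipart_upper)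
    show 2: "ipart \<kappa>" using *(2) 1 by (rule interlaces_ipart_lower)
    have bd: "\<mu> (Suc i) \<le> \<rho> i \<and> \<rho> i \<le> \<mu> i \<and> \<mu> (Suc i) \<le> \<kappa> i \<and> \<kappa> i \<le> \<mu> i" for i
      using * by (auto simp: interlaces_def)
    have bd': "lo \<kappa> (Suc i) \<le> \<mu> (Suc i)" "\<mu> (Suc i) \<le> hi \<kappa> i" for i
      using bd[of i] bd[of "Suc i"] by (auto simp: lo_def hi_def)
    show 3: "lo \<kappa> 0 \<le> \<mu> 0" using bd[of 0] by (auto simp: lo_def)
    have bd2: "lo \<kappa> (Suc i) \<le> down \<kappa> \<mu> i" "down \<kappa> \<mu> i \<le> hi \<kappa> i" for i
      using bd'[of i] by (auto simp: down_def)
    show 4: "down \<kappa> \<mu> i + \<mu> (Suc i) = lo \<kappa> (Suc i) + hi \<kappa> i" for i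
      using bd'[of i] by (auto simp: down_def)
    show 5: "down \<kappa> \<mu> \<lless> \<rho>" "down \<kappa> \<mu> \<lless> \<kappa>"
      using bd2 by (auto simp: interlaces_def lo_def hi_def)
    show 6: "ipart (down \<kappa> \<mu>)" using 5(1) ip by (rule interlaces_ipart_lower)
    show "psize (down \<kappa> \<mu>) + m = psize \<kappa> + (\<mu> 0 - lo \<kappa> 0)"
      using psize_exchange[OF ip 2 1 6, unfolded lo_def[symmetric] hi_def[symmetric], OF 4] *(3) 3 by linarith
  qed
  have B: "ipart \<sigma>" "ipart \<kappa>" "ipart (up \<kappa> \<sigma>)" "\<rho> \<lless> up \<kappa> \<sigma>" "\<kappa> \<lless> up \<kappa> \<sigma>"
    "\<And>i. \<sigma> i + up \<kappa> \<sigma> (Suc i) = lo \<kappa> (Suc i) + hi \<kappa> i"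
    "psize (up \<kappa> \<sigma>) = psize \<rho> + m"
    if "(\<sigma>, \<kappa>) \<in> B" for \<sigma> \<kappa>
  proof -
    have *: "\<sigma> \<lless> \<rho>" "\<sigma> \<lless> \<kappa>" "psize \<kappa> \<le> psize \<sigma> + m" using that by (auto simp: B_def)
    show 1: "ipart \<sigma>" using *(1) ip by (rule interlaces_ipart_lower)
    show 2: "ipart \<kappa>" using *(2) 1 by (rule interlaces_ipart_upper)
    have bd: "\<rho> (Suc i) \<le> \<sigma> i \<and> \<sigma> i \<le> \<rho> i \<and> \<kappa> (Suc i) \<le> \<sigma> i \<and> \<sigma> i \<le> \<kappa> i" for i
      using * by (auto simp: interlaces_def)
    have bd': "lo \<kappa> (Suc i) \<le> \<sigma> i" "\<sigma> i \<le> hi \<kappa> i" for i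
      using bd[of i] by (auto simp: lo_def hi_def)
    have bd2: "lo \<kappa> (Suc i) \<le> up \<kappa> \<sigma> (Suc i)" "up \<kappa> \<sigma> (Suc i) \<le> hi \<kappa> i" for i
      using bd'[of i] by (auto simp: up_def)
    have bd3: "lo \<kappa> i \<le> up \<kappa> \<sigma> i" for i
      using bd2 by (cases i) (auto simp: up_def)
    show 4: "\<sigma> i + up \<kappa> \<sigma> (Suc i) = lo \<kappa> (Suc i) + hi \<kappa> i" for i
      using bd'[of i] by (auto simp: up_def)
    show 5: "\<rho> \<lless> up \<kappa> \<sigma>" "\<kappa> \<lless> up \<kappa> \<sigma>"
      using bd2 bd3 by (auto simp: interlaces_def lo_def hi_def)
    show 6: "ipart (up \<kappa> \<sigma>)" using 5(1) ip by (rule interlaces_ipart_upper)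
    have "up \<kappa> \<sigma> 0 = lo \<kappa> 0 + (psize \<sigma> + m - psize \<kappa>)" by (simp add: up_def)
    then show "psize (up \<kappa> \<sigma>) = psize \<rho> + m"
      using psize_exchange[OF ip 2 6 1, unfolded lo_def[symmetric] hi_def[symmetric], OF 4] *(3) by linarith
  qed
  have "(\<Sum>\<mu> | \<rho> \<lless> \<mu> \<and> psize \<mu> = psize \<rho> + m. \<Sum>\<kappa> | \<kappa> \<lless> \<mu>. f \<kappa>) = (\<Sum>(\<mu>, \<kappa>)\<in>A. f \<kappa>)"
    unfolding A_def
    by (rule sum.Sigma) (auto intro: finite_interlaces_upper ip finite_interlaces_lower interlaces_ipart_upper)
  also have "\<dots> = (\<Sum>(\<sigma>, \<kappa>)\<in>B. f \<kappa>)"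
  proof (rule sum.reindex_bij_witness[where i = "\<lambda>(\<sigma>, \<kappa>). (up \<kappa> \<sigma>, \<kappa>)" and j = "\<lambda>(\<mu>, \<kappa>). (down \<kappa> \<mu>, \<kappa>)"], goal_cases)
    case (1 a)
    obtain \<mu> \<kappa> where a: "a = (\<mu>, \<kappa>)" by (cases a)
    note A' = A[OF 1[unfolded a]]
    have "up \<kappa> (down \<kappa> \<mu>) i = \<mu> i" for i
    proof (cases i)
      case 0 then show ?thesis using A'(7,8) by (simp add: up_def)
    next
      case (Suc k) then show ?thesis using A'(6)[of k] by (simp add: up_def)
    qed
    then show ?case by (auto simp: a)
  next
    case (2 a)
    obtain \<mu> \<kappa> where a: "a = (\<mu>, \<kappa>)" by (cases a)
    from A(4,5,8)[OF 2[unfolded a]] show ?case by (simp add: a B_def)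
  next
    case (3 b)
    obtain \<sigma> \<kappa> where b: "b = (\<sigma>, \<kappa>)" by (cases b)
    have "down \<kappa> (up \<kappa> \<sigma>) i = \<sigma> i" for i
      using B(6)[OF 3[unfolded b], of i] by (simp add: down_def)
    then show ?case by (auto simp: b)
  next
    case (4 b)
    obtain \<sigma> \<kappa> where b: "b = (\<sigma>, \<kappa>)" by (cases b)
    from B(4,5,7)[OF 4[unfolded b]] show ?case by (simp add: b A_def)
  qed auto
  also have "\<dots> = (\<Sum>\<sigma> | \<sigma> \<lless> \<rho>. \<Sum>\<kappa> | \<sigma> \<lless> \<kappa> \<and> psize \<kappa> \<le> psize \<sigma> + m. f \<kappa>)"
    unfolding B_def by (rule sum.Sigma[symmetric]) (auto intro: finite_interlaces_lower ip finB)
  finally show ?thesis .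
qed

lemma sum_power_div_qpoch:
  assumes "generic t" shows "(\<Sum>k\<le>m. t ^ k / qpoch t k) = 1 / qpoch t m"
proof (induction m)
  case (Suc m)
  have "1 - t ^ Suc m \<noteq> 0" using generic_power_neq_1[OF assms, of "Suc m"] by simp
  then show ?case using Suc qpoch_nonzero[OF assms, of m] by (simp add: qpoch_Suc field_simps)
qed simp

text \<open>Expanding each summand by the branching rule and applying
  \<open>interlaces_exchange\<close> expresses the sum through Pieri sums for the pairs (\<sigma>,
  \<open>k\<close>) with \<sigma> below \<rho> and \<open>k \<le> m\<close>. The pair (\<rho>,
  \<open>m\<close>) is the only one of maximal total size; the others are known by induction. The
  claimed values satisfy the same linear relation, so the two sides agree after division by
  \<open>1 - t ^ (psize \<rho> + m)\<close>.\<close>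

lemma schur_pieri:
  assumes t: "generic t" and "ipart \<rho>"
  shows "(\<Sum>\<mu> | \<rho> \<lless> \<mu> \<and> psize \<mu> = psize \<rho> + m. schur t \<mu>) = schur t \<rho> / qpoch t m"
  using assms(2)
proof (induction "psize \<rho> + m" arbitrary: \<rho> m rule: less_induct)
  case less
  note ip = \<open>ipart \<rho>\<close>
  define P where "P \<rho> m = (\<Sum>\<mu> | \<rho> \<lless> \<mu> \<and> psize \<mu> = psize \<rho> + m. schur t \<mu>)" for \<rho> m
  show ?case
  proof (cases "psize \<rho> + m = 0")
    case True
    then have "{\<mu>. \<rho> \<lless> \<mu> \<and> psize \<mu> = psize \<rho> + m} = {\<rho>}"
      using interlaces_refl[OF ip] psize_interlaces_eq[of \<rho>] interlaces_ipart_upper[OF _ ip] by auto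
    then show ?thesis using True by simp
  next
    case False
    have inner: "(\<Sum>\<kappa> | \<sigma> \<lless> \<kappa> \<and> psize \<kappa> \<le> psize \<sigma> + m. t ^ psize \<kappa> * schur t \<kappa>) =
        (\<Sum>k\<le>m. t ^ (psize \<sigma> + k) * P \<sigma> k)" if "\<sigma> \<lless> \<rho>" for \<sigma>
    proof -
      have ips: "ipart \<sigma>" using that ip by (rule interlaces_ipart_lower)
      have "{\<kappa>. \<sigma> \<lless> \<kappa> \<and> psize \<kappa> \<le> psize \<sigma> + m} = (\<Union>k\<le>m. {\<kappa>. \<sigma> \<lless> \<kappa> \<and> psize \<kappa> = psize \<sigma> + k})"
      proof (intro equalityI subsetI)
        fix \<kappa> assume "\<kappa> \<in> {\<kappa>. \<sigma> \<lless> \<kappa> \<and> psize \<kappa> \<le> psize \<sigma> + m}"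
        then have \<kappa>: "\<sigma> \<lless> \<kappa>" "psize \<kappa> \<le> psize \<sigma> + m" by auto
        then have "psize \<sigma> \<le> psize \<kappa>" using ips by (auto intro: psize_interlaces_le interlaces_ipart_upper)
        then have "psize \<kappa> = psize \<sigma> + (psize \<kappa> - psize \<sigma>)" "psize \<kappa> - psize \<sigma> \<le> m" using \<kappa> by auto
        then show "\<kappa> \<in> (\<Union>k\<le>m. {\<kappa>. \<sigma> \<lless> \<kappa> \<and> psize \<kappa> = psize \<sigma> + k})" using \<kappa>(1) by blast
      qed auto
      then have "(\<Sum>\<kappa> | \<sigma> \<lless> \<kappa> \<and> psize \<kappa> \<le> psize \<sigma> + m. t ^ psize \<kappa> * schur t \<kappa>) =
          (\<Sum>k\<le>m. \<Sum>\<kappa> | \<sigma> \<lless> \<kappa> \<and> psize \<kappa> = psize \<sigma> + k. t ^ psize \<kappa> * schur t \<kappa>)"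
        using finite_interlaces_upper[OF ips] by (subst sum.UNION_disjoint[symmetric]) auto
      also have "\<dots> = (\<Sum>k\<le>m. t ^ (psize \<sigma> + k) * P \<sigma> k)"
        by (intro sum.cong) (auto simp: P_def sum_distrib_left)
      finally show ?thesis .
    qed
    have "P \<rho> m = (\<Sum>\<mu> | \<rho> \<lless> \<mu> \<and> psize \<mu> = psize \<rho> + m. \<Sum>\<kappa> | \<kappa> \<lless> \<mu>. t ^ psize \<kappa> * schur t \<kappa>)"
      unfolding P_def by (intro sum.cong schur_branching t) (auto intro: interlaces_ipart_upper ip)
    also have "\<dots> = (\<Sum>\<sigma> | \<sigma> \<lless> \<rho>. \<Sum>k\<le>m. t ^ (psize \<sigma> + k) * P \<sigma> k)"
      unfolding interlaces_exchange[OF ip] by (intro sum.cong) (auto simp: inner)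
    also have "\<dots> = (\<Sum>(\<sigma>, k)\<in>{\<sigma>. \<sigma> \<lless> \<rho>} \<times> {..m}. t ^ (psize \<sigma> + k) * P \<sigma> k)"
      by (rule sum.cartesian_product)
    also have "\<dots> = t ^ (psize \<rho> + m) * P \<rho> m
        + (\<Sum>(\<sigma>, k)\<in>{\<sigma>. \<sigma> \<lless> \<rho>} \<times> {..m} - {(\<rho>, m)}. t ^ (psize \<sigma> + k) * P \<sigma> k)"
      using interlaces_refl[OF ip] finite_interlaces_lower[OF ip] by (subst sum.remove[of _ "(\<rho>, m)"]) auto
    also have "(\<Sum>(\<sigma>, k)\<in>{\<sigma>. \<sigma> \<lless> \<rho>} \<times> {..m} - {(\<rho>, m)}. t ^ (psize \<sigma> + k) * P \<sigma> k) =
        (\<Sum>(\<sigma>, k)\<in>{\<sigma>. \<sigma> \<lless> \<rho>} \<times> {..m} - {(\<rho>, m)}. t ^ (psize \<sigma> + k) * (schur t \<sigma> / qpoch t k))"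
    proof (rule sum.cong, goal_cases)
      case (2 x)
      then obtain \<sigma> k where x: "x = (\<sigma>, k)" "\<sigma> \<lless> \<rho>" "k \<le> m" "\<sigma> \<noteq> \<rho> \<or> k \<noteq> m" by auto
      have "psize \<sigma> + k < psize \<rho> + m"
        using psize_interlaces[OF x(2) ip] x(3,4) by linarith
      from less.hyps[OF this interlaces_ipart_lower[OF x(2) ip]]
      show ?case by (simp add: x P_def)
    qed simp
    \<comment> \<open>Adding and subtracting the claimed value at (\<rho>, \<open>m\<close>)
      completes the index set to a full product, over which the sum factorises.\<close>
    also have "\<dots> = (\<Sum>(\<sigma>, k)\<in>{\<sigma>. \<sigma> \<lless> \<rho>} \<times> {..m}. t ^ (psize \<sigma> + k) * (schur t \<sigma> / qpoch t k))
        - t ^ (psize \<rho> + m) * (schur t \<rho> / qpoch t m)"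
      using interlaces_refl[OF ip] finite_interlaces_lower[OF ip] by (subst sum_diff1) auto
    also have "(\<Sum>(\<sigma>, k)\<in>{\<sigma>. \<sigma> \<lless> \<rho>} \<times> {..m}. t ^ (psize \<sigma> + k) * (schur t \<sigma> / qpoch t k)) =
        (\<Sum>\<sigma> | \<sigma> \<lless> \<rho>. t ^ psize \<sigma> * schur t \<sigma>) * (\<Sum>k\<le>m. t ^ k / qpoch t k)"
      unfolding sum_product sum.cartesian_product by (intro sum.cong) (auto simp: power_add)
    also have "\<dots> = schur t \<rho> / qpoch t m"
      using schur_branching[OF t ip] by (simp add: sum_power_div_qpoch[OF t])
    finally have "(1 - t ^ (psize \<rho> + m)) * P \<rho> m = (1 - t ^ (psize \<rho> + m)) * (schur t \<rho> / qpoch t m)"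
      by (simp add: algebra_simps)
    moreover have "1 - t ^ (psize \<rho> + m) \<noteq> 0"
      using generic_power_neq_1[OF t, of "psize \<rho> + m"] False by simp
    ultimately have "P \<rho> m = schur t \<rho> / qpoch t m" by (metis mult_left_cancel)
    then show ?thesis by (simp only: P_def)
  qed
qed

definition cauchy_coeff :: "real \<Rightarrow> nat \<Rightarrow> real" where
  "cauchy_coeff t n = (\<Sum>\<alpha>\<in>Par n. (schur t \<alpha>)\<^sup>2)"

text \<open>One of the two Schur factors is expanded by the branching rule. After exchanging the
  summations the other is summed over all \<alpha> above \<mu>, which is a Pieri sum with
  \<open>k = n - psize \<mu>\<close>.\<close>

lemma cauchy_coeff_rec:
  assumes t: "generic t"
  shows "cauchy_coeff t n = (\<Sum>k\<le>n. 1 / qpoch t k * (t ^ (n - k) * cauchy_coeff t (n - k)))"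
proof -
  have ipP: "ipart \<alpha>" "psize \<alpha> = m" if "\<alpha> \<in> Par m" for \<alpha> m using that by (auto simp: Par_def)
  have "cauchy_coeff t n = (\<Sum>\<alpha>\<in>Par n. \<Sum>\<mu> | \<mu> \<lless> \<alpha>. schur t \<alpha> * (t ^ psize \<mu> * schur t \<mu>))"
    unfolding cauchy_coeff_def
  proof (rule sum.cong, goal_cases)
    case (2 \<alpha>)
    have "(schur t \<alpha>)\<^sup>2 = schur t \<alpha> * (\<Sum>\<mu> | \<mu> \<lless> \<alpha>. t ^ psize \<mu> * schur t \<mu>)"
      using schur_branching[OF t ipP(1)[OF 2]] by (simp add: power2_eq_square)
    then show ?case by (simp add: sum_distrib_left)
  qed simp
  also have "\<dots> = (\<Sum>(\<alpha>, \<mu>)\<in>(SIGMA \<alpha>:Par n. {\<mu>. \<mu> \<lless> \<alpha>}). schur t \<alpha> * (t ^ psize \<mu> * schur t \<mu>))"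
    by (rule sum.Sigma) (auto intro: finite_Par finite_interlaces_lower ipP)
  also have "\<dots> = (\<Sum>(\<mu>, \<alpha>)\<in>(SIGMA \<mu>:(\<Union>k\<le>n. Par (n - k)). {\<alpha>. \<mu> \<lless> \<alpha> \<and> psize \<alpha> = n}).
      schur t \<alpha> * (t ^ psize \<mu> * schur t \<mu>))"
  proof (rule sum.reindex_bij_witness[where i = prod.swap and j = prod.swap], goal_cases)
    case (2 x)
    then obtain \<alpha> \<mu> where x: "x = (\<alpha>, \<mu>)" "\<alpha> \<in> Par n" "\<mu> \<lless> \<alpha>" by auto
    have "psize \<mu> \<le> n" "ipart \<mu>"
      using psize_interlaces_le[OF x(3)] interlaces_ipart_lower[OF x(3)] ipP[OF x(2)] by auto
    then have "\<mu> \<in> Par (n - (n - psize \<mu>))" by (simp add: Par_def)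
    then show ?case using ipP[OF x(2)] x(3) by (auto simp: x(1))
  next
    case (4 x)
    then show ?case using interlaces_ipart_upper by (auto simp: Par_def)
  qed auto
  also have "\<dots> = (\<Sum>\<mu>\<in>(\<Union>k\<le>n. Par (n - k)). \<Sum>\<alpha> | \<mu> \<lless> \<alpha> \<and> psize \<alpha> = n. schur t \<alpha> * (t ^ psize \<mu> * schur t \<mu>))"
    by (rule sum.Sigma[symmetric]) (auto intro!: finite_Par finite_interlaces_upper ipP)
  also have "\<dots> = (\<Sum>k\<le>n. \<Sum>\<mu>\<in>Par (n - k). \<Sum>\<alpha> | \<mu> \<lless> \<alpha> \<and> psize \<alpha> = n. schur t \<alpha> * (t ^ psize \<mu> * schur t \<mu>))"
    by (rule sum.UNION_disjoint) (auto simp: finite_Par, auto simp: Par_def)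
  also have "\<dots> = (\<Sum>k\<le>n. 1 / qpoch t k * (t ^ (n - k) * cauchy_coeff t (n - k)))"
  proof (rule sum.cong, goal_cases)
    case (2 k)
    have "(\<Sum>\<alpha> | \<mu> \<lless> \<alpha> \<and> psize \<alpha> = n. schur t \<alpha> * (t ^ psize \<mu> * schur t \<mu>)) =
        1 / qpoch t k * (t ^ (n - k) * (schur t \<mu>)\<^sup>2)" if "\<mu> \<in> Par (n - k)" for \<mu>
    proof -
      have "n = psize \<mu> + k" using ipP[OF that] 2 by simp
      then show ?thesis
        using schur_pieri[OF t ipP(1)[OF that], of k] ipP(2)[OF that]
        by (simp add: sum_distrib_right[symmetric] power2_eq_square)
    qed
    then show ?case by (simp add: cauchy_coeff_def sum_distrib_left)
  qed simp
  finally show ?thesis .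
qed

section \<open>Nonnegative integrality\<close>

text \<open>Agreement is asked only at generic points: at \<open>t = 1\<close> the quotients to be
  treated can have zero denominators, and division then returns 0.\<close>

definition nonneg_int_poly_fun :: "(real \<Rightarrow> real) \<Rightarrow> bool" where
  "nonneg_int_poly_fun f \<longleftrightarrow> (\<exists>p :: int poly. (\<forall>i. coeff p i \<ge> 0) \<and>
     (\<forall>t. generic t \<longrightarrow> f t = poly (map_poly of_int p) t))"

lemma nonneg_int_poly_fun_cong:
  "(\<And>t. generic t \<Longrightarrow> f t = g t) \<Longrightarrow> nonneg_int_poly_fun g \<Longrightarrow> nonneg_int_poly_fun f"
  by (auto simp: nonneg_int_poly_fun_def)

lemma nonneg_int_poly_fun_power: "nonneg_int_poly_fun (\<lambda>t. t ^ k)"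
  unfolding nonneg_int_poly_fun_def
  by (rule exI[of _ "monom 1 k"]) (auto simp: map_poly_monom poly_monom)

lemma nonneg_int_poly_fun_add:
  assumes "nonneg_int_poly_fun f" "nonneg_int_poly_fun g"
  shows "nonneg_int_poly_fun (\<lambda>t. f t + g t)"
proof -
  obtain p q :: "int poly" where
    "\<forall>i. coeff p i \<ge> 0" "\<forall>t. generic t \<longrightarrow> f t = poly (map_poly of_int p) t"
    "\<forall>i. coeff q i \<ge> 0" "\<forall>t. generic t \<longrightarrow> g t = poly (map_poly of_int q) t"
    using assms unfolding nonneg_int_poly_fun_def by blast
  moreover have "map_poly of_int (p + q) = (map_poly of_int p + map_poly of_int q :: real poly)"
    by (intro poly_eqI) (simp add: coeff_map_poly)
  ultimately show ?thesis
    unfolding nonneg_int_poly_fun_def by (intro exI[of _ "p + q"]) auto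
qed

lemma nonneg_int_poly_fun_mult:
  assumes "nonneg_int_poly_fun f" "nonneg_int_poly_fun g"
  shows "nonneg_int_poly_fun (\<lambda>t. f t * g t)"
proof -
  obtain p q :: "int poly" where
    "\<forall>i. coeff p i \<ge> 0" "\<forall>t. generic t \<longrightarrow> f t = poly (map_poly of_int p) t"
    "\<forall>i. coeff q i \<ge> 0" "\<forall>t. generic t \<longrightarrow> g t = poly (map_poly of_int q) t"
    using assms unfolding nonneg_int_poly_fun_def by blast
  moreover have "map_poly of_int (p * q) = (map_poly of_int p * map_poly of_int q :: real poly)"
    by (intro poly_eqI) (simp add: coeff_map_poly coeff_mult)
  ultimately show ?thesis
    unfolding nonneg_int_poly_fun_def by (intro exI[of _ "p * q"]) (auto simp: coeff_mult intro!: sum_nonneg)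
qed

lemma nonneg_int_poly_fun_sum:
  assumes "\<And>x. x \<in> A \<Longrightarrow> nonneg_int_poly_fun (f x)"
  shows "nonneg_int_poly_fun (\<lambda>t. \<Sum>x\<in>A. f x t)"
  using assms
proof (induction A rule: infinite_finite_induct)
  case (insert x A)
  then show ?case by (simp add: nonneg_int_poly_fun_add)
qed (auto simp: nonneg_int_poly_fun_def intro: exI[of _ 0])

text \<open>The nonempty horizontal strips \<alpha>/\<mu> whose topmost row is
  \<open>i\<close>.\<close>

definition strips_from :: "(nat \<Rightarrow> nat) \<Rightarrow> nat \<Rightarrow> (nat \<Rightarrow> nat) set" where
  "strips_from \<alpha> i = {\<mu>. \<mu> \<lless> \<alpha> \<and> \<mu> i < \<alpha> i \<and> (\<forall>j<i. \<mu> j = \<alpha> j)}"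

text \<open>Classify \<mu> by the first row in which it differs from \<alpha>. Rows from
  \<open>psize \<alpha>\<close> on are empty and cannot be the first.\<close>

lemma sum_strips_from:
  fixes f :: "(nat \<Rightarrow> nat) \<Rightarrow> 'a :: comm_monoid_add"
  assumes ip: "ipart \<alpha>"
  shows "(\<Sum>\<mu> | \<mu> \<lless> \<alpha> \<and> (\<forall>j<i. \<mu> j = \<alpha> j). f \<mu>) =
    f \<alpha> + (\<Sum>j\<in>{i..<psize \<alpha>}. \<Sum>\<mu>\<in>strips_from \<alpha> j. f \<mu>)"
proof -
  have fin: "finite (strips_from \<alpha> j)" for j
    using finite_interlaces_lower[OF ip] by (rule finite_subset[rotated]) (auto simp: strips_from_def)
  have disj: "j < k \<Longrightarrow> strips_from \<alpha> j \<inter> strips_from \<alpha> k = {}" for j k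
    by (auto simp: strips_from_def)
  have "{\<mu>. \<mu> \<lless> \<alpha> \<and> (\<forall>j<i. \<mu> j = \<alpha> j)} = insert \<alpha> (\<Union>j\<in>{i..<psize \<alpha>}. strips_from \<alpha> j)" (is "?L = ?R")
  proof (intro equalityI subsetI)
    fix \<mu> assume "\<mu> \<in> ?L"
    then have \<mu>: "\<mu> \<lless> \<alpha>" "\<forall>j<i. \<mu> j = \<alpha> j" by auto
    show "\<mu> \<in> ?R"
    proof (cases "\<mu> = \<alpha>")
      case False
      define k where "k = (LEAST k. \<mu> k \<noteq> \<alpha> k)"
      have k: "\<mu> k \<noteq> \<alpha> k" unfolding k_def by (rule LeastI_ex) (use False in \<open>simp add: fun_eq_iff\<close>)
      have least: "\<mu> j = \<alpha> j" if "j < k" for j using not_less_Least[of j "\<lambda>k. \<mu> k \<noteq> \<alpha> k"] that by (auto simp: k_def)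
      have "\<mu> k < \<alpha> k" using k \<mu>(1) by (auto simp: interlaces_def order.strict_iff_order)
      moreover from this have "k < psize \<alpha>" using ipart_eq_0[OF ip, of k] by (cases "psize \<alpha> \<le> k") auto
      moreover have "i \<le> k" using \<mu>(2) k by (meson not_le)
      ultimately show ?thesis using least \<mu>(1) by (auto simp: strips_from_def)
    qed simp
  next
    fix \<mu> assume "\<mu> \<in> ?R"
    then show "\<mu> \<in> ?L" using interlaces_refl[OF ip] by (auto simp: strips_from_def)
  qed
  moreover have "\<alpha> \<notin> (\<Union>j\<in>{i..<psize \<alpha>}. strips_from \<alpha> j)" by (auto simp: strips_from_def)
  moreover have "(\<Sum>\<mu>\<in>(\<Union>j\<in>{i..<psize \<alpha>}. strips_from \<alpha> j). f \<mu>) = (\<Sum>j\<in>{i..<psize \<alpha>}. \<Sum>\<mu>\<in>strips_from \<alpha> j. f \<mu>)"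
    using fin disj by (intro sum.UNION_disjoint) (auto, metis disjoint_iff linorder_neqE_nat)
  ultimately show ?thesis using fin by simp
qed

definition strip_sum :: "real \<Rightarrow> (nat \<Rightarrow> nat) \<Rightarrow> nat \<Rightarrow> real" where
  "strip_sum t \<alpha> i = (\<Sum>\<mu>\<in>strips_from \<alpha> i. t ^ psize \<mu> * schur t \<mu>)"

text \<open>This is the branching rule with the term \<mu> = \<alpha> moved to the left.\<close>

lemma schur_eq_strip_sums:
  assumes "generic t" "ipart \<alpha>"
  shows "(1 - t ^ psize \<alpha>) * schur t \<alpha> = (\<Sum>i<psize \<alpha>. strip_sum t \<alpha> i)"
  using schur_branching[OF assms] sum_strips_from[OF assms(2), of "\<lambda>\<mu>. t ^ psize \<mu> * schur t \<mu>" 0]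
  by (simp add: strip_sum_def lessThan_atLeast0 algebra_simps)

text \<open>A strip with topmost row \<open>i\<close> contains the last box of that row. Once this
  box is removed, what is left is a possibly empty strip of \<beta> in rows \<open>i\<close> and
  below.\<close>

lemma remove_box:
  assumes ip: "ipart \<alpha>" and "\<alpha> (Suc i) < \<alpha> i"
  defines "\<beta> \<equiv> \<alpha>(i := \<alpha> i - 1)"
  shows "ipart \<beta>" and "psize \<alpha> = Suc (psize \<beta>)"
    and "strips_from \<alpha> i = {\<mu>. \<mu> \<lless> \<beta> \<and> (\<forall>j<i. \<mu> j = \<beta> j)}"
proof -
  obtain N where N: "\<forall>i\<ge>N. \<alpha> i = 0" using ip by (rule ipart_bound)
  have "i < N" using N[rule_format, of i] assms(2) by (cases "N \<le> i") auto
  have anti: "\<alpha> (Suc k) \<le> \<alpha> k" for k using ip by (auto intro: ipart_antimono)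
  have N': "\<beta> k = 0" if "k \<ge> N" for k
    using N[rule_format, OF that] \<open>i < N\<close> that by (simp add: \<beta>_def)
  show "ipart \<beta>"
  proof (rule ipartI[of _ N])
    show "\<beta> (Suc k) \<le> \<beta> k" for k
      using anti[of k] assms(2) by (auto simp: \<beta>_def)
  qed (rule N')
  have "psize \<alpha> = (\<Sum>j<N. \<alpha> j)" "psize \<beta> = (\<Sum>j<N. \<beta> j)"
    by (rule psize_eq, use N in simp) (rule psize_eq, rule N')
  moreover have "(\<Sum>j<N. \<alpha> j) = \<alpha> i + (\<Sum>j\<in>{..<N} - {i}. \<alpha> j)"
    "(\<Sum>j<N. \<beta> j) = \<beta> i + (\<Sum>j\<in>{..<N} - {i}. \<alpha> j)"
    using \<open>i < N\<close> by (auto simp: sum.remove[of _ i] \<beta>_def)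
  ultimately show "psize \<alpha> = Suc (psize \<beta>)" using assms(2) by (simp add: \<beta>_def)
  show "strips_from \<alpha> i = {\<mu>. \<mu> \<lless> \<beta> \<and> (\<forall>j<i. \<mu> j = \<beta> j)}"
  proof (intro equalityI subsetI)
    fix \<mu> assume "\<mu> \<in> strips_from \<alpha> i"
    then have \<mu>: "\<mu> \<lless> \<alpha>" "\<mu> i < \<alpha> i" "\<forall>j<i. \<mu> j = \<alpha> j" by (auto simp: strips_from_def)
    have "\<beta> (Suc k) \<le> \<mu> k \<and> \<mu> k \<le> \<beta> k" for k
    proof -
      have "\<beta> (Suc k) \<le> \<alpha> (Suc k)" by (simp add: \<beta>_def)
      moreover have "\<alpha> (Suc k) \<le> \<mu> k" "\<mu> k \<le> \<alpha> k" using \<mu>(1) by (auto simp: interlaces_def)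
      ultimately have "\<beta> (Suc k) \<le> \<mu> k" "\<mu> k \<le> \<alpha> k" by simp_all
      then show ?thesis using \<mu>(2) by (cases "k = i") (auto simp: \<beta>_def)
    qed
    then show "\<mu> \<in> {\<mu>. \<mu> \<lless> \<beta> \<and> (\<forall>j<i. \<mu> j = \<beta> j)}" using \<mu>(3) by (auto simp: interlaces_def \<beta>_def)
  next
    fix \<mu> assume "\<mu> \<in> {\<mu>. \<mu> \<lless> \<beta> \<and> (\<forall>j<i. \<mu> j = \<beta> j)}"
    then have \<mu>: "\<And>k. \<beta> (Suc k) \<le> \<mu> k \<and> \<mu> k \<le> \<beta> k" "\<forall>j<i. \<mu> j = \<alpha> j" by (auto simp: interlaces_def \<beta>_def)
    have "\<alpha> (Suc k) \<le> \<mu> k \<and> \<mu> k \<le> \<alpha> k" for k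
    \<comment> \<open>Only in the row just above \<open>i\<close> is the lower bound coming from
      \<beta> too weak by one; there \<mu> agrees with \<alpha>.\<close>
    proof (cases "Suc k = i")
      case True
      then show ?thesis using \<mu>(2) anti[of k] by auto
    next
      case False
      then show ?thesis using \<mu>(1)[of k] by (auto simp: \<beta>_def split: if_splits)
    qed
    moreover have "\<mu> i < \<alpha> i" using \<mu>(1)[of i] assms(2) by (auto simp: \<beta>_def)
    ultimately show "\<mu> \<in> strips_from \<alpha> i" using \<mu>(2) by (auto simp: strips_from_def interlaces_def)
  qed
qed

lemma schur_empty: "ipart \<alpha> \<Longrightarrow> psize \<alpha> = 0 \<Longrightarrow> generic t \<Longrightarrow> schur t \<alpha> = 1"
  using schur_eq_schur_rows[of t 0 \<alpha>] ipart_eq_0[of \<alpha>] by (simp add: schur_rows_def)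

text \<open>The recursion behind the next lemma is that of the major index generating functions of
  standard tableaux of shape \<open>\<alpha>\<close> whose largest entry lies in row \<open>i\<close>.\<close>

lemma nonneg_int_poly_fun_strip_sum:
  assumes "ipart \<alpha>" "psize \<alpha> = Suc n"
  shows "nonneg_int_poly_fun (\<lambda>t. strip_sum t \<alpha> i * qpoch t n)"
  using assms
proof (induction n arbitrary: \<alpha> i)
  case (0 \<alpha> i)
  show ?case
  proof (cases "\<alpha> (Suc i) < \<alpha> i")
    case True
    define \<beta> where "\<beta> = \<alpha>(i := \<alpha> i - 1)"
    note rb = remove_box[OF 0(1) True, folded \<beta>_def]
    have "strip_sum t \<alpha> i = schur t \<beta>" for t
      unfolding strip_sum_def rb(3) sum_strips_from[OF rb(1)] using rb(2) 0(2) by simp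
    then show ?thesis
      using rb 0(2)
      by (intro nonneg_int_poly_fun_cong[OF _ nonneg_int_poly_fun_power[of 0]]) (auto simp: schur_empty)
  next
    case False
    then have "strips_from \<alpha> i = {}" by (force simp: strips_from_def interlaces_def dest: le_less_trans)
    then show ?thesis
      by (auto simp: nonneg_int_poly_fun_def strip_sum_def intro: exI[of _ 0])
  qed
next
  case (Suc n \<alpha> i)
  show ?case
  proof (cases "\<alpha> (Suc i) < \<alpha> i")
    case True
    define \<beta> where "\<beta> = \<alpha>(i := \<alpha> i - 1)"
    note rb = remove_box[OF Suc(2) True, folded \<beta>_def]
    have sz: "psize \<beta> = Suc n" using rb(2) Suc(3) by simp
    have "strip_sum t \<alpha> i * qpoch t (Suc n) =
        (\<Sum>j<Suc n. t ^ (if i \<le> j then 0 else Suc n) * (strip_sum t \<beta> j * qpoch t n))" if t: "generic t" for t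
    proof -
      define s where "s j = strip_sum t \<beta> j" for j
      have "strip_sum t \<alpha> i = t ^ Suc n * schur t \<beta> + (\<Sum>j\<in>{i..<Suc n}. s j)"
        unfolding strip_sum_def rb(3) sum_strips_from[OF rb(1)] sz s_def ..
      also have "(\<Sum>j\<in>{i..<Suc n}. s j) = (\<Sum>j<Suc n. if i \<le> j then s j else 0)"
        by (rule sum.mono_neutral_cong_left) auto
      \<comment> \<open>The factor \<open>1 - t ^ Suc n\<close> lets the Schur term be expanded into
        strip sums too. Rows \<open>j < i\<close> then keep the weight \<open>t ^ Suc n\<close>,
        while for \<open>j \<ge> i\<close> the weights add up to 1, so no negative coefficient
        remains.\<close>
      finally have "strip_sum t \<alpha> i * (1 - t ^ Suc n) =
          t ^ Suc n * ((1 - t ^ Suc n) * schur t \<beta>) + (1 - t ^ Suc n) * (\<Sum>j<Suc n. if i \<le> j then s j else 0)"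
        by (simp only: algebra_simps)
      also have "(1 - t ^ Suc n) * schur t \<beta> = (\<Sum>j<Suc n. s j)"
        using schur_eq_strip_sums[OF t rb(1)] by (simp only: sz s_def)
      also have "t ^ Suc n * (\<Sum>j<Suc n. s j) + (1 - t ^ Suc n) * (\<Sum>j<Suc n. if i \<le> j then s j else 0) =
          (\<Sum>j<Suc n. t ^ (if i \<le> j then 0 else Suc n) * s j)"
        unfolding sum_distrib_left sum.distrib[symmetric] by (intro sum.cong) (auto simp: algebra_simps)
      finally have "strip_sum t \<alpha> i * (1 - t ^ Suc n) * qpoch t n =
          (\<Sum>j<Suc n. t ^ (if i \<le> j then 0 else Suc n) * s j) * qpoch t n" by simp
      then show ?thesis
        unfolding qpoch_Suc s_def sum_distrib_right by (simp only: mult_ac)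
    qed
    moreover have "nonneg_int_poly_fun (\<lambda>t. \<Sum>j<Suc n. t ^ (if i \<le> j then 0 else Suc n) * (strip_sum t \<beta> j * qpoch t n))"
      by (intro nonneg_int_poly_fun_sum nonneg_int_poly_fun_mult nonneg_int_poly_fun_power Suc.IH rb(1) sz)
    ultimately show ?thesis by (rule nonneg_int_poly_fun_cong)
  next
    case False
    then have "strips_from \<alpha> i = {}" by (force simp: strips_from_def interlaces_def dest: le_less_trans)
    then show ?thesis
      by (auto simp: nonneg_int_poly_fun_def strip_sum_def intro: exI[of _ 0])
  qed
qed

lemma nonneg_int_poly_fun_schur:
  assumes ip: "ipart \<alpha>"
  shows "nonneg_int_poly_fun (\<lambda>t. schur t \<alpha> * qpoch t (psize \<alpha>))"
proof (cases "psize \<alpha>")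
  case 0
  show ?thesis
    by (rule nonneg_int_poly_fun_cong[OF _ nonneg_int_poly_fun_power[of 0]]) (use 0 ip in \<open>auto simp: schur_empty\<close>)
next
  case (Suc n)
  have "schur t \<alpha> * qpoch t (psize \<alpha>) = (\<Sum>i<Suc n. strip_sum t \<alpha> i * qpoch t n)" if "generic t" for t
    using schur_eq_strip_sums[OF that ip] unfolding Suc qpoch_Suc sum_distrib_right[symmetric]
    by (simp add: mult_ac)
  moreover have "nonneg_int_poly_fun (\<lambda>t. \<Sum>i<Suc n. strip_sum t \<alpha> i * qpoch t n)"
    by (intro nonneg_int_poly_fun_sum nonneg_int_poly_fun_strip_sum ip Suc)
  ultimately show ?thesis by (rule nonneg_int_poly_fun_cong)
qed

text \<open>\<open>J_n\<close> at \<open>q = 1 / t\<close> without its leading power of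
  \<open>q\<close>, see \<open>J_n_eq\<close>; thus a coefficient reversal of
  \<open>J_n\<close>.\<close>

definition J_rev :: "nat \<Rightarrow> real \<Rightarrow> real" where
  "J_rev n t = cauchy_coeff t n * (qpoch t n)\<^sup>2"

lemma nonneg_int_poly_fun_J_rev: "nonneg_int_poly_fun (J_rev n)"
proof -
  have "J_rev n t = (\<Sum>\<alpha>\<in>Par n. (schur t \<alpha> * qpoch t (psize \<alpha>)) * (schur t \<alpha> * qpoch t (psize \<alpha>)))" for t
    unfolding J_rev_def cauchy_coeff_def sum_distrib_right
    by (intro sum.cong) (auto simp: Par_def power2_eq_square)
  then show ?thesis
    by (intro nonneg_int_poly_fun_cong[of "J_rev n"], assumption)
      (auto intro!: nonneg_int_poly_fun_sum nonneg_int_poly_fun_mult nonneg_int_poly_fun_schur simp: Par_def)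
qed

section \<open>Palindromicity and special values\<close>

lemma generic_inverse: "generic t \<Longrightarrow> generic (1 / t)"
  by (auto simp: generic_def)

section \<open>The functional equation of the Cauchy series and its behaviour under inverting
  \<open>t\<close>\<close>

definition fps_dilate :: "real \<Rightarrow> real fps \<Rightarrow> real fps" where
  "fps_dilate c f = f oo (fps_const c * fps_X)"

lemma fps_nth_dilate [simp]: "fps_nth (fps_dilate c f) n = c ^ n * fps_nth f n"
  by (simp add: fps_dilate_def)

lemma fps_dilate_mult: "fps_dilate c (f * g) = fps_dilate c f * fps_dilate c g"
  by (simp add: fps_dilate_def fps_compose_mult_distrib)

lemma fps_dilate_dilate: "fps_dilate c (fps_dilate d f) = fps_dilate (c * d) f"
  by (simp add: fps_eq_iff power_mult_distrib)

lemma fps_dilate_1 [simp]: "fps_dilate 1 f = f"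
  by (simp add: fps_eq_iff)

text \<open>The series \<open>E(u)\<close>. Giving its coefficients rather than Euler's infinite
  product makes it available for |t| > 1 as well.\<close>

definition euler_fps :: "real \<Rightarrow> real fps" where
  "euler_fps t = Abs_fps (\<lambda>n. 1 / qpoch t n)"

definition cauchy_fps :: "real \<Rightarrow> real fps" where
  "cauchy_fps t = Abs_fps (cauchy_coeff t)"

lemma euler_fps_dilate:
  assumes "generic t" shows "fps_dilate t (euler_fps t) = (1 - fps_X) * euler_fps t"
proof (rule fps_ext)
  fix n
  show "fps_nth (fps_dilate t (euler_fps t)) n = fps_nth ((1 - fps_X) * euler_fps t) n"
  proof (cases n)
    case (Suc m)
    have "1 - t ^ Suc m \<noteq> 0" using generic_power_neq_1[OF assms, of "Suc m"] by simp
    then show ?thesis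
      using qpoch_nonzero[OF assms, of m]
      by (simp add: Suc euler_fps_def left_diff_distrib qpoch_Suc field_simps)
  qed (simp add: euler_fps_def)
qed

lemma cauchy_fps_rec:
  assumes "generic t" shows "cauchy_fps t = euler_fps t * fps_dilate t (cauchy_fps t)"
proof (rule fps_ext)
  fix n
  show "fps_nth (cauchy_fps t) n = fps_nth (euler_fps t * fps_dilate t (cauchy_fps t)) n"
    using cauchy_coeff_rec[OF assms, of n]
    by (simp add: cauchy_fps_def euler_fps_def fps_mult_nth atMost_atLeast0)
qed

text \<open>In the coefficient of \<open>u^n\<close> the unknown \<open>f_n\<close> has the factor
  \<open>1 - t ^ n\<close>, and all other terms have smaller index.\<close>

lemma fps_dilate_rec_unique:
  assumes t: "generic t" and E: "fps_nth E 0 = 1"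
    and f: "f = E * fps_dilate t f" and g: "g = E * fps_dilate t g" and 0: "fps_nth f 0 = fps_nth g 0"
  shows "f = g"
proof (rule fps_ext)
  fix n
  have rec: "(1 - t ^ n) * fps_nth h n = (\<Sum>i=1..n. fps_nth E i * (t ^ (n - i) * fps_nth h (n - i)))"
    if "h = E * fps_dilate t h" for h n
  proof -
    have "fps_nth h n = fps_nth (E * fps_dilate t h) n" using that by simp
    then show ?thesis by (simp add: fps_mult_nth sum.atLeast_Suc_atMost E algebra_simps)
  qed
  show "fps_nth f n = fps_nth g n"
  proof (induction n rule: less_induct)
    case (less n)
    show ?case
    proof (cases "n = 0")
      case False
      have "(1 - t ^ n) * fps_nth f n = (1 - t ^ n) * fps_nth g n"
        unfolding rec[OF f] rec[OF g] using less False by (intro sum.cong) auto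
      then show ?thesis using generic_power_neq_1[OF t, of n] False by simp
    qed (use 0 in simp)
  qed
qed

text \<open>Dilation by \<open>1 / t\<close> moves one factor \<open>1 - u\<close> from one series
  to the other and so fixes the product; a series fixed by this dilation is constant.\<close>

lemma euler_fps_inverse:
  assumes t: "generic t"
  shows "euler_fps (1 / t) * fps_dilate t (euler_fps t) = 1" (is "?X = 1")
proof -
  have t0: "t \<noteq> 0" using t by (simp add: generic_def)
  have "fps_dilate (1 / t) ?X = ((1 - fps_X) * euler_fps (1 / t)) * euler_fps t"
    using euler_fps_dilate[OF generic_inverse[OF t]] t0 by (simp add: fps_dilate_mult fps_dilate_dilate)
  also have "\<dots> = ?X" by (simp add: euler_fps_dilate[OF t] mult_ac)
  finally have "(1 / t) ^ n * fps_nth ?X n = fps_nth ?X n" for n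
    by (metis fps_nth_dilate)
  then have "fps_nth ?X n = 0" if "n > 0" for n
    using generic_power_neq_1[OF generic_inverse[OF t] that] by (metis mult_cancel_right1)
  moreover have "fps_nth ?X 0 = 1" by (simp add: euler_fps_def)
  ultimately show ?thesis by (intro fps_ext) (auto simp: gr0_conv_Suc)
qed

lemma Par_0: "Par 0 = {\<lambda>_. 0}"
proof (intro equalityI subsetI)
  fix \<alpha> assume "\<alpha> \<in> Par 0"
  then have "ipart \<alpha>" "psize \<alpha> = 0" by (auto simp: Par_def)
  then have "\<alpha> i = 0" for i using ipart_eq_0[of \<alpha> i] by simp
  then show "\<alpha> \<in> {\<lambda>_. 0}" by auto
next
  fix \<alpha> :: "nat \<Rightarrow> nat" assume "\<alpha> \<in> {\<lambda>_. 0}"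
  then have "\<alpha> = (\<lambda>_. 0)" by simp
  moreover have "ipart (\<lambda>_. 0)" by (rule ipartI[of _ 0]) simp_all
  moreover have "psize (\<lambda>_. 0) = 0" by (simp add: psize_def)
  ultimately show "\<alpha> \<in> Par 0" by (simp add: Par_def)
qed

lemma cauchy_coeff_0: "generic t \<Longrightarrow> cauchy_coeff t 0 = 1"
proof -
  assume t: "generic t"
  have "(\<lambda>_. 0) \<in> Par 0" by (simp add: Par_0)
  then have "schur t (\<lambda>_. 0) = 1" using t by (intro schur_empty) (simp_all add: Par_def)
  then show ?thesis by (simp add: cauchy_coeff_def Par_0)
qed

text \<open>Put \<open>B(u) = A(t^2 u)\<close>. Multiplying \<open>A(t u) = E(t u) B(u)\<close> by
  the Euler series at \<open>1 / t\<close> gives the functional equation at \<open>1 / t\<close> for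
  \<open>B\<close>, because \<open>A(t u) = B(u / t)\<close>. Uniqueness identifies \<open>B\<close>
  with the Cauchy series at \<open>1 / t\<close>.\<close>

lemma cauchy_coeff_inverse:
  assumes t: "generic t"
  shows "cauchy_coeff (1 / t) n = t ^ (2 * n) * cauchy_coeff t n"
proof -
  note ti = generic_inverse[OF t]
  have t0: "t \<noteq> 0" using t by (simp add: generic_def)
  let ?B = "fps_dilate (t * t) (cauchy_fps t)"
  have "fps_dilate t (cauchy_fps t) = fps_dilate t (euler_fps t) * ?B"
    by (subst cauchy_fps_rec[OF t]) (simp add: fps_dilate_mult fps_dilate_dilate)
  then have "euler_fps (1 / t) * fps_dilate t (cauchy_fps t) = ?B"
    using euler_fps_inverse[OF t] by (simp flip: mult.assoc)
  then have B: "?B = euler_fps (1 / t) * fps_dilate (1 / t) ?B"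
    using t0 by (simp add: fps_dilate_dilate)
  have "cauchy_fps (1 / t) = ?B"
    by (rule fps_dilate_rec_unique[OF ti _ cauchy_fps_rec[OF ti] B])
      (simp_all add: euler_fps_def cauchy_fps_def cauchy_coeff_0 t ti)
  then have "fps_nth (cauchy_fps (1 / t)) n = fps_nth ?B n" by simp
  then show ?thesis by (simp add: cauchy_fps_def power_mult power2_eq_square)
qed

text \<open>Each factor obeys \<open>t^k (1 - t^(-k)) = -(1 - t^k)\<close>; squaring removes the
  sign, and twice the sum of the \<open>k\<close> is \<open>n * (n + 1)\<close>.\<close>

lemma qpoch_inverse_square:
  assumes "t \<noteq> 0" shows "t ^ (n * (n + 1)) * (qpoch (1 / t) n)\<^sup>2 = (qpoch t n)\<^sup>2"
proof (induction n)
  case (Suc n)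
  have "t ^ Suc n * (1 - (1 / t) ^ Suc n) = - (1 - t ^ Suc n)"
    using assms by (simp add: power_one_over field_simps del: power_Suc)
  then have *: "(t ^ Suc n * (1 - (1 / t) ^ Suc n))\<^sup>2 = (1 - t ^ Suc n)\<^sup>2" by (simp only: power2_minus)
  have "t ^ (Suc n * (Suc n + 1)) = t ^ (n * (n + 1)) * (t ^ Suc n)\<^sup>2"
  proof -
    have "Suc n * (Suc n + 1) = n * (n + 1) + Suc n * 2" by simp
    then show ?thesis by (simp only: power_add power_mult)
  qed
  then have "t ^ (Suc n * (Suc n + 1)) * (qpoch (1 / t) (Suc n))\<^sup>2 =
      (t ^ (n * (n + 1)) * (qpoch (1 / t) n)\<^sup>2) * (t ^ Suc n * (1 - (1 / t) ^ Suc n))\<^sup>2"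
    by (simp only: qpoch_Suc power_mult_distrib mult_ac)
  then show ?case unfolding Suc * by (simp only: qpoch_Suc power_mult_distrib)
qed simp

lemma J_rev_palindromic:
  assumes t: "generic t"
  shows "t ^ (n * (n - 1)) * J_rev n (1 / t) = J_rev n t"
proof -
  have "n * (n - 1) + 2 * n = n * (n + 1)" by (cases n) auto
  then have "t ^ (n * (n - 1)) * t ^ (2 * n) = t ^ (n * (n + 1))" by (simp only: power_add[symmetric])
  have "t ^ (n * (n - 1)) * J_rev n (1 / t) =
      cauchy_coeff t n * ((t ^ (n * (n - 1)) * t ^ (2 * n)) * (qpoch (1 / t) n)\<^sup>2)"
    unfolding J_rev_def cauchy_coeff_inverse[OF t] by (simp only: mult_ac)
  also have "t ^ (n * (n - 1)) * t ^ (2 * n) = t ^ (n * (n + 1))" by fact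
  also have "\<dots> * (qpoch (1 / t) n)\<^sup>2 = (qpoch t n)\<^sup>2"
    using t by (intro qpoch_inverse_square) (simp add: generic_def)
  finally show ?thesis by (simp add: J_rev_def)
qed

section \<open>q-factorials and the limits at \<open>t = 0\<close> and \<open>t = 1\<close>\<close>

definition qint :: "nat \<Rightarrow> real \<Rightarrow> real" where
  "qint m t = (\<Sum>i<m. t ^ i)"

definition qfact :: "nat \<Rightarrow> real \<Rightarrow> real" where
  "qfact m t = (\<Prod>k=1..m. qint k t)"

lemma qfact_0 [simp]: "qfact 0 t = 1"
  by (simp add: qfact_def)

lemma qfact_Suc: "qfact (Suc m) t = qfact m t * qint (Suc m) t"
  by (simp add: qfact_def)

text \<open>Isolates the zero of order \<open>m\<close> at \<open>t = 1\<close>; the cofactor is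
  positive for \<open>t \<ge> 0\<close>.\<close>

lemma qpoch_eq_qfact: "qpoch t m = (1 - t) ^ m * qfact m t"
proof (induction m)
  case (Suc m)
  have "1 - t ^ Suc m = (1 - t) * qint (Suc m) t"
    unfolding qint_def by (rule one_diff_power_eq)
  then show ?case using Suc by (simp only: qpoch_Suc qfact_Suc power_Suc mult_ac)
qed simp

lemma qfact_pos: "t \<ge> 0 \<Longrightarrow> qfact m t > 0"
proof (induction m)
  case (Suc m)
  have "0 < qint (Suc m) t"
    unfolding qint_def sum.lessThan_Suc_shift using Suc by (simp add: add_pos_nonneg sum_nonneg)
  then show ?case using Suc by (simp add: qfact_Suc)
qed simp

lemma isCont_qfact: "isCont (qfact m) x"
  unfolding qfact_def qint_def by (intro continuous_intros)

text \<open>Multiply the recurrence by \<open>(t;t)_n (t;t)_{n-1}\<close>, which also absorbs the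
  factor \<open>1 - t ^ n\<close>. The net power of \<open>1 - t\<close> is
  \<open>n + (n - 1) - k - 2 (n - k) = k - 1\<close>, so no singularity is left at
  \<open>t = 1\<close>.\<close>

lemma J_rev_rec:
  assumes t: "generic t" and n: "n > 0" and pos: "t > 0"
  shows "J_rev n t = (\<Sum>k=1..n. t ^ (n - k) * J_rev (n - k) t * ((1 - t) ^ (k - 1) *
    (qfact n t * qfact (n - 1) t / (qfact k t * (qfact (n - k) t)\<^sup>2))))"
proof -
  obtain m where m: "n = Suc m" using n by (cases n) auto
  have nz: "1 - t ^ n \<noteq> 0" using generic_power_neq_1[OF t n] by simp
  have "(1 - t ^ n) * cauchy_coeff t n = (\<Sum>k=1..n. 1 / qpoch t k * (t ^ (n - k) * cauchy_coeff t (n - k)))"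
  proof -
    have "cauchy_coeff t n = t ^ n * cauchy_coeff t n
        + (\<Sum>k=1..n. 1 / qpoch t k * (t ^ (n - k) * cauchy_coeff t (n - k)))"
      by (subst cauchy_coeff_rec[OF t]) (simp add: atMost_atLeast0 sum.atLeast_Suc_atMost)
    then show ?thesis by (simp add: algebra_simps)
  qed
  moreover have "J_rev n t = (qpoch t n * qpoch t m) * ((1 - t ^ n) * cauchy_coeff t n)"
    by (simp only: J_rev_def m qpoch_Suc power2_eq_square mult_ac)
  ultimately have "J_rev n t = (\<Sum>k=1..n. (qpoch t n * qpoch t m) * (1 / qpoch t k * (t ^ (n - k) * cauchy_coeff t (n - k))))"
    by (simp add: sum_distrib_left)
  also have "\<dots> = (\<Sum>k=1..n. t ^ (n - k) * J_rev (n - k) t * ((1 - t) ^ (k - 1) *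
    (qfact n t * qfact (n - 1) t / (qfact k t * (qfact (n - k) t)\<^sup>2))))"
  proof (rule sum.cong, goal_cases)
    case (2 k)
    define c where "c = cauchy_coeff t (n - k)"
    have t1: "1 - t \<noteq> 0" using t by (auto simp: generic_def)
    have q: "qfact k t \<noteq> 0" "qfact (n - k) t \<noteq> 0" using qfact_pos[of t] pos by (auto simp: less_imp_neq[symmetric])
    have "n + m = k + ((k - 1) + (n - k) * 2)" using 2 m by auto
    then have e: "(1 - t) ^ n * (1 - t) ^ m = (1 - t) ^ k * ((1 - t) ^ (k - 1) * ((1 - t) ^ (n - k))\<^sup>2)"
      by (simp only: power_add[symmetric] power_mult[symmetric])
    have "qpoch t n * qpoch t m * (1 / qpoch t k * (t ^ (n - k) * c)) =
        ((1 - t) ^ n * (1 - t) ^ m) * (qfact n t * qfact m t) * t ^ (n - k) * c / ((1 - t) ^ k * qfact k t)"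
      by (simp add: qpoch_eq_qfact)
    also have "\<dots> = t ^ (n - k) * (c * (qpoch t (n - k))\<^sup>2) * ((1 - t) ^ (k - 1) *
        (qfact n t * qfact m t / (qfact k t * (qfact (n - k) t)\<^sup>2)))"
      unfolding e qpoch_eq_qfact using t1 q by (simp add: power_mult_distrib)
    finally show ?case by (simp add: m J_rev_def c_def)
  qed simp
  finally show ?thesis .
qed

lemma eventually_generic: "x \<in> {0, 1} \<Longrightarrow> eventually (\<lambda>t. generic t \<and> t > 0) (at_right x)"
proof -
  assume "x \<in> {0, 1}"
  then consider "x = 0" | "x = 1" by auto
  then show ?thesis
  proof cases
    case 1
    have "eventually (\<lambda>t. t \<in> {0<..<1}) (at_right (0 :: real))" by (rule eventually_at_right_real) simp
    then show ?thesis unfolding 1 by eventually_elim (auto simp: generic_def)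
  next
    case 2
    have "eventually (\<lambda>t. t \<in> {1<..<2}) (at_right (1 :: real))" by (rule eventually_at_right_real) simp
    then show ?thesis unfolding 2 by eventually_elim (auto simp: generic_def)
  qed
qed

text \<open>The recurrence holds for generic \<open>t\<close> just to the right of \<open>x\<close>,
  and both sides are continuous at \<open>x\<close>.\<close>

lemma J_rev_poly_rec:
  fixes P :: "nat \<Rightarrow> real poly"
  assumes P: "\<And>m t. generic t \<Longrightarrow> J_rev m t = poly (P m) t" and n: "n > 0" and x: "x \<in> {0, 1}"
  shows "poly (P n) x = (\<Sum>k=1..n. x ^ (n - k) * poly (P (n - k)) x * ((1 - x) ^ (k - 1) *
    (qfact n x * qfact (n - 1) x / (qfact k x * (qfact (n - k) x)\<^sup>2))))" (is "_ = ?R x")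
proof -
  have ne: "qfact m x \<noteq> 0" for m using qfact_pos[of x m] x by auto
  have "isCont ?R x"
    using ne by (intro continuous_intros isCont_qfact) auto
  then have "(?R \<longlongrightarrow> ?R x) (at_right x)"
    by (simp add: isCont_def filterlim_at_split)
  moreover have "(poly (P n) \<longlongrightarrow> poly (P n) x) (at_right x)"
    by (intro tendsto_intros)
  moreover have "eventually (\<lambda>t. ?R t = poly (P n) t) (at_right x)"
    using eventually_generic[OF x] by eventually_elim (use J_rev_rec[OF _ n] P in simp)
  ultimately have "(poly (P n) \<longlongrightarrow> ?R x) (at_right x)"
    using Lim_transform_eventually by fast
  with \<open>(poly (P n) \<longlongrightarrow> poly (P n) x) (at_right x)\<close> show ?thesis
    by (intro tendsto_unique[of "at_right x"]) auto
qed

text \<open>At 0 the power of \<open>t\<close> leaves only the term \<open>k = n\<close>. At 1 the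
  power of \<open>1 - t\<close> leaves only \<open>k = 1\<close>, and passing from \<open>n\<close>
  to \<open>Suc n\<close> multiplies the value by \<open>qint (Suc n) 1 = Suc n\<close>.\<close>

lemma J_rev_poly_values:
  fixes P :: "nat \<Rightarrow> real poly"
  assumes P: "\<And>m t. generic t \<Longrightarrow> J_rev m t = poly (P m) t"
  shows "poly (P n) 0 = 1" and "poly (P n) 1 = fact n"
proof -
  have base: "P 0 = [:1:]"
  proof -
    \<comment> \<open>\<open>P 0\<close> is known only at generic points, but infinitely many of
      these determine it.\<close>
    have "poly (P 0 - [:1:]) t = 0" if "t > 1" for t
      using P[of t 0] that by (auto simp: generic_def J_rev_def cauchy_coeff_0)
    then have "{1<..} \<subseteq> {t. poly (P 0 - [:1:]) t = 0}" by auto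
    then have "infinite {t. poly (P 0 - [:1:]) t = 0}"
      using infinite_Ioi[of "1 :: real"] finite_subset by blast
    then show ?thesis using poly_roots_finite[of "P 0 - [:1:]"] by auto
  qed
  show "poly (P n) 0 = 1"
  proof (cases "n = 0")
    case False
    have "poly (P n) 0 = (\<Sum>k\<in>{n}. 0 ^ (n - k) * poly (P (n - k)) 0 * ((1 - 0) ^ (k - 1) *
        (qfact n 0 * qfact (n - 1) 0 / (qfact k 0 * (qfact (n - k) 0)\<^sup>2))))"
      by (subst J_rev_poly_rec[OF P]; (rule sum.mono_neutral_right)?) (use False in auto)
    also have "\<dots> = 1"
    proof -
      have "qint (Suc m) 0 = 1" for m by (simp add: qint_def sum.lessThan_Suc_shift del: sum.lessThan_Suc)
      then have "qfact m 0 = 1" for m by (induction m) (auto simp: qfact_Suc)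
      then show ?thesis by (simp add: base)
    qed
    finally show ?thesis .
  qed (simp add: base)
  show "poly (P n) 1 = fact n"
  proof (induction n)
    case (Suc n)
    have "poly (P (Suc n)) 1 = (\<Sum>k\<in>{1}. 1 ^ (Suc n - k) * poly (P (Suc n - k)) 1 * ((1 - 1) ^ (k - 1) *
        (qfact (Suc n) 1 * qfact (Suc n - 1) 1 / (qfact k 1 * (qfact (Suc n - k) 1)\<^sup>2))))"
      by (subst J_rev_poly_rec[OF P]; (rule sum.mono_neutral_right)?) auto
    also have "\<dots> = fact (Suc n)"
    proof -
      have "qfact n 1 > 0" by (rule qfact_pos) simp
      then show ?thesis using Suc by (simp add: qfact_Suc qint_def power2_eq_square)
    qed
    finally show ?case .
  qed (simp add: base)
qed

section \<open>Hook lengths\<close>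

definition part_fun :: "nat list \<Rightarrow> nat \<Rightarrow> nat" where
  "part_fun lam i = (if i < length lam then lam ! i else 0)"

lemma is_partition_nth_mono:
  "is_partition n lam \<Longrightarrow> i \<le> j \<Longrightarrow> j < length lam \<Longrightarrow> lam ! j \<le> lam ! i"
  by (auto simp: is_partition_def sorted_rev_iff_nth_mono)

lemma part_fun_in_Par:
  assumes "is_partition n lam" shows "part_fun lam \<in> Par n"
proof -
  have "ipart (part_fun lam)"
    by (rule ipartI[of _ "length lam"]) (auto simp: part_fun_def intro: is_partition_nth_mono[OF assms])
  moreover have "psize (part_fun lam) = (\<Sum>i<length lam. part_fun lam i)"
    by (rule psize_eq) (simp add: part_fun_def)
  moreover have "\<dots> = sum_list lam"
    by (simp add: part_fun_def sum_list_sum_nth lessThan_atLeast0)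
  ultimately show ?thesis using assms by (simp add: Par_def is_partition_def)
qed

lemma inj_on_part_fun: "inj_on part_fun (partitions n)"
proof (rule inj_onI)
  fix l l' assume l: "l \<in> partitions n" "l' \<in> partitions n" and eq: "part_fun l = part_fun l'"
  have pos: "i < length k \<longleftrightarrow> part_fun k i \<noteq> 0" if "k \<in> partitions n" for k i
    using that by (auto simp: partitions_def is_partition_def part_fun_def)
  have "i < length l \<longleftrightarrow> i < length l'" for i
    using pos[OF l(1), of i] pos[OF l(2), of i] eq by simp
  then have len: "length l = length l'" by (metis less_irrefl linorder_neqE_nat)
  show "l = l'"
  proof (rule nth_equalityI[OF len])
    fix i assume "i < length l"
    then show "l ! i = l' ! i" using fun_cong[OF eq, of i] len by (simp add: part_fun_def)
  qed
qed

lemma part_fun_image: "part_fun ` partitions n = Par n"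
proof (intro equalityI subsetI)
  fix \<alpha> assume "\<alpha> \<in> Par n"
  then have ip: "ipart \<alpha>" and sz: "psize \<alpha> = n" by (auto simp: Par_def)
  define L where "L = (LEAST N. \<forall>i\<ge>N. \<alpha> i = 0)"
  obtain N where N: "\<forall>i\<ge>N. \<alpha> i = 0" using ip by (rule ipart_bound)
  have L: "\<forall>i\<ge>L. \<alpha> i = 0" unfolding L_def by (rule LeastI[of _ N]) (rule N)
  have pos: "\<alpha> i > 0" if "i < L" for i
  proof (rule ccontr)
    assume "\<not> \<alpha> i > 0"
    then have "\<forall>j\<ge>i. \<alpha> j = 0" using ipart_antimono[OF ip, of i] by (metis gr0I le_zero_eq)
    then have "L \<le> i" unfolding L_def by (rule Least_le)
    then show False using that by simp
  qed
  let ?l = "map \<alpha> [0..<L]"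
  have "part_fun ?l = \<alpha>" using L by (intro ext) (simp add: part_fun_def)
  moreover have "sum_list ?l = n"
    using psize_eq[of L \<alpha>] L sz by (simp add: interv_sum_list_conv_sum_set_nat lessThan_atLeast0)
  then have "?l \<in> partitions n"
    using pos ipart_antimono[OF ip] by (auto simp: partitions_def is_partition_def sorted_rev_iff_nth_mono)
  ultimately show "\<alpha> \<in> part_fun ` partitions n" by (metis image_eqI)
qed (auto simp: partitions_def intro: part_fun_in_Par)

text \<open>The rows with more than \<open>j\<close> boxes form an initial segment, so their number
  determines them.\<close>

lemma conj_part_iff:
  assumes "is_partition n lam"
  shows "i < length lam \<and> j < lam ! i \<longleftrightarrow> i < conj_part lam j"
proof -
  define S where "S = {i. i < length lam \<and> j < lam ! i}"
  define c where "c = (LEAST k. k \<notin> S)"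
  have c: "c \<notin> S" unfolding c_def by (rule LeastI[of _ "length lam"]) (simp add: S_def)
  have "S = {..<c}"
  proof (intro equalityI subsetI)
    fix k assume k: "k \<in> S"
    show "k \<in> {..<c}"
    proof (rule ccontr)
      assume "k \<notin> {..<c}"
      then have "c \<le> k" by simp
      then have "c \<in> S" using k is_partition_nth_mono[OF assms, of c k] by (auto simp: S_def)
      then show False using c by simp
    qed
  next
    fix k assume "k \<in> {..<c}"
    then show "k \<in> S" using not_less_Least[of k "\<lambda>k. k \<notin> S"] by (auto simp: c_def)
  qed
  moreover from this have "conj_part lam j = c" by (simp add: conj_part_def S_def[symmetric])
  ultimately show ?thesis by (auto simp: S_def)
qed

text \<open>The hook lengths in row \<open>i\<close> and the differences \<open>l\<^sub>i - l\<^sub>k\<close> for \<open>k > i\<close>, where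
  \<open>l\<^sub>k = \<lambda>\<^sub>k + N - 1 - k\<close>, partition \<open>{1..l\<^sub>i}\<close>.\<close>

lemma hook_row:
  assumes part: "is_partition n lam" and i: "i < length lam"
  shows "qpoch t (lam ! i + (length lam - 1 - i)) =
    (\<Prod>j<lam ! i. 1 - t ^ hook lam (i, j)) *
    (\<Prod>k\<in>{i<..<length lam}. 1 - t ^ (lam ! i - lam ! k + (k - i)))"
proof -
  define N where "N = length lam"
  define c where "c j = conj_part lam j" for j
  define h where "h j = hook lam (i, j)" for j
  define d where "d k = lam ! i - lam ! k + (k - i)" for k
  have c_iff: "k < N \<and> j < lam ! k \<longleftrightarrow> k < c j" for k j
    unfolding N_def c_def by (rule conj_part_iff[OF part])
  have mono: "lam ! k \<le> lam ! k'" if "k' \<le> k" "k < N" for k k'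
    using is_partition_nth_mono[OF part] that by (simp add: N_def)
  have cN: "c j \<le> N" for j
    using c_iff[of "c j - 1" j] by (cases "c j") auto
  have ci: "i < c j" if "j < lam ! i" for j using c_iff[of i j] i that by (simp add: N_def)
  have h: "h j = (lam ! i - j - 1) + (c j - i - 1) + 1" for j by (simp add: h_def hook_def c_def)
  have c_anti: "c j' \<le> c j" if "j \<le> j'" for j j'
  proof (rule ccontr)
    assume "\<not> c j' \<le> c j"
    then have "c j < N \<and> j' < lam ! c j" using c_iff[of "c j" j'] by simp
    then show False using c_iff[of "c j" j] that by simp
  qed
  have inj_h: "inj_on h {..<lam ! i}"
  proof -
    have "h j' < h j" if "j < j'" "j' < lam ! i" for j j'
      using that c_anti[of j j'] ci[of j] ci[of j'] by (simp add: h)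
    then show ?thesis by (intro inj_onI) (metis lessThan_iff less_irrefl linorder_neqE_nat)
  qed
  have inj_d: "inj_on d {i<..<N}"
  proof -
    have "d k < d k'" if "i < k" "k < k'" "k' < N" for k k'
      using that mono[of k k'] mono[of i k] mono[of i k'] by (simp add: d_def)
    then show ?thesis by (intro inj_onI) (metis greaterThanLessThan_iff less_irrefl linorder_neqE_nat)
  qed
  \<comment> \<open>\<open>h j\<close> exceeds \<open>d k\<close> if the box (\<open>k\<close>,
    \<open>j\<close>) lies in the diagram, and is smaller than \<open>d k\<close> otherwise.\<close>
  have disj: "h ` {..<lam ! i} \<inter> d ` {i<..<N} = {}"
  proof -
    have "h j \<noteq> d k" if "j < lam ! i" "i < k" "k < N" for j k
    proof (cases "j < lam ! k")
      case True
      then have "k < c j" using c_iff[of k j] that by simp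
      then show ?thesis using True that mono[of i k] by (simp add: h d_def)
    next
      case False
      then have "c j \<le> k" using c_iff[of k j] that by simp
      then show ?thesis using False that mono[of i k] ci[of j] by (simp add: h d_def)
    qed
    then show ?thesis by auto
  qed
  have sub: "h ` {..<lam ! i} \<union> d ` {i<..<N} \<subseteq> {1..lam ! i + (N - 1 - i)}"
  proof -
    have "h j \<in> {1..lam ! i + (N - 1 - i)}" if "j < lam ! i" for j
      using that ci[of j] cN[of j] by (simp add: h)
    moreover have "d k \<in> {1..lam ! i + (N - 1 - i)}" if "i < k" "k < N" for k
      unfolding d_def atLeastAtMost_iff using that by linarith
    ultimately show ?thesis by auto
  qed
  \<comment> \<open>The two disjoint images have together as many elements as the interval
    containing them, hence fill it.\<close>
  have "card (h ` {..<lam ! i} \<union> d ` {i<..<N}) = lam ! i + (N - 1 - i)"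
    by (subst card_Un_disjoint) (use disj in \<open>auto simp: card_image[OF inj_h] card_image[OF inj_d]\<close>)
  then have "h ` {..<lam ! i} \<union> d ` {i<..<N} = {1..lam ! i + (N - 1 - i)}"
    by (intro card_subset_eq sub) auto
  then have "qpoch t (lam ! i + (N - 1 - i)) = (\<Prod>m\<in>h ` {..<lam ! i} \<union> d ` {i<..<N}. 1 - t ^ m)"
    by (simp add: qpoch_def)
  also have "\<dots> = (\<Prod>m\<in>h ` {..<lam ! i}. 1 - t ^ m) * (\<Prod>m\<in>d ` {i<..<N}. 1 - t ^ m)"
    by (rule prod.union_disjoint) (use disj in auto)
  finally show ?thesis
    unfolding prod.reindex[OF inj_h] prod.reindex[OF inj_d] o_def by (simp only: h_def d_def N_def)
qed

text \<open>Multiplying \<open>hook_row\<close> over all rows turns the denominator into the hook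
  product times the product over pairs in the numerator, which cancels.\<close>

lemma schur_part_fun:
  assumes part: "is_partition n lam" and t: "generic t"
  shows "schur t (part_fun lam) = t ^ n_stat lam / (\<Prod>s\<in>boxes lam. 1 - t ^ hook lam s)"
proof -
  define N where "N = length lam"
  let ?X = "\<lambda>i j. 1 - t ^ (lam ! i - lam ! j + (j - i))"
  have "schur t (part_fun lam) = schur_rows t N (part_fun lam)"
    by (rule schur_eq_schur_rows[OF t]) (simp add: part_fun_def N_def)
  also have "\<dots> = schur_rows t N ((!) lam)"
    by (rule schur_rows_cong) (simp add: part_fun_def N_def)
  also have "\<dots> = t ^ n_stat lam * (\<Prod>j<N. \<Prod>i<j. ?X i j) / (\<Prod>i<N. qpoch t (lam ! i + (N - 1 - i)))"
    by (simp add: schur_rows_def N_def n_stat_def)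
  also have "(\<Prod>i<N. qpoch t (lam ! i + (N - 1 - i))) =
      (\<Prod>i<N. \<Prod>j<lam ! i. 1 - t ^ hook lam (i, j)) * (\<Prod>i<N. \<Prod>j\<in>{i<..<N}. ?X i j)"
    unfolding prod.distrib[symmetric] N_def by (intro prod.cong refl hook_row[OF part]) simp
  also have "(\<Prod>i<N. \<Prod>j<lam ! i. 1 - t ^ hook lam (i, j)) = (\<Prod>s\<in>boxes lam. 1 - t ^ hook lam s)"
  proof -
    have "boxes lam = (SIGMA i:{..<N}. {..<lam ! i})" by (auto simp: boxes_def N_def)
    then show ?thesis by (simp add: prod.Sigma case_prod_beta')
  qed
  also have "(\<Prod>i<N. \<Prod>j\<in>{i<..<N}. ?X i j) = (\<Prod>j<N. \<Prod>i<j. ?X i j)"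
  proof -
    have "(\<Prod>i<N. \<Prod>j\<in>{i<..<N}. ?X i j) = (\<Prod>i<N. \<Prod>j<N. if i < j then ?X i j else 1)"
      by (intro prod.cong prod.mono_neutral_cong_left) auto
    also have "\<dots> = (\<Prod>j<N. \<Prod>i<N. if i < j then ?X i j else 1)" by (rule prod.swap)
    also have "\<dots> = (\<Prod>j<N. \<Prod>i<j. ?X i j)"
      by (intro prod.cong prod.mono_neutral_cong_right) auto
    finally show ?thesis .
  qed
  finally have "schur t (part_fun lam) = t ^ n_stat lam * (\<Prod>j<N. \<Prod>i<j. ?X i j) /
      ((\<Prod>s\<in>boxes lam. 1 - t ^ hook lam s) * (\<Prod>j<N. \<Prod>i<j. ?X i j))" .
  moreover have "(\<Prod>j<N. \<Prod>i<j. ?X i j) \<noteq> 0"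
    using generic_power_neq_1[OF t] by auto
  ultimately show ?thesis by simp
qed

lemma J_part_eq:
  assumes part: "is_partition n lam" and q: "generic q"
  shows "J_part lam q = q ^ (n * (n - 1)) * ((schur (1 / q) (part_fun lam))\<^sup>2 * (qpoch (1 / q) n)\<^sup>2)"
proof -
  have q0: "q \<noteq> 0" using q by (simp add: generic_def)
  have sum: "sum_list lam = n" using part by (simp add: is_partition_def)
  have powi: "q powi (- int k) = (1 / q) ^ k" for k
    by (simp add: power_int_minus power_one_over inverse_eq_divide)
  have "int n ^ 2 - int n - 2 * int (n_stat lam) = int (n * (n - 1)) - int (n_stat lam * 2)"
    by (cases n) (auto simp: power2_eq_square algebra_simps)
  then have "q powi (int n ^ 2 - int n - 2 * int (n_stat lam)) = q ^ (n * (n - 1)) / q ^ (n_stat lam * 2)"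
    unfolding power_int_of_nat[symmetric] by (simp only: power_int_diff[OF disjI1[OF q0]])
  also have "\<dots> = q ^ (n * (n - 1)) * ((1 / q) ^ n_stat lam)\<^sup>2"
    by (simp add: power_one_over power_mult)
  finally show ?thesis
    unfolding J_part_def Let_def sum powi schur_part_fun[OF part generic_inverse[OF q]]
    by (simp add: qpoch_def prod_power_distrib power_divide power_mult_distrib)
qed

lemma J_n_eq:
  assumes "generic q"
  shows "J_n n q = q ^ (n * (n - 1)) * J_rev n (1 / q)"
proof -
  have "J_n n q = (\<Sum>lam\<in>partitions n. q ^ (n * (n - 1)) * ((schur (1 / q) (part_fun lam))\<^sup>2 * (qpoch (1 / q) n)\<^sup>2))"
    unfolding J_n_def by (intro sum.cong) (auto simp: J_part_eq[OF _ assms] partitions_def)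
  also have "\<dots> = (\<Sum>\<alpha>\<in>Par n. q ^ (n * (n - 1)) * ((schur (1 / q) \<alpha>)\<^sup>2 * (qpoch (1 / q) n)\<^sup>2))"
    unfolding part_fun_image[symmetric] by (subst sum.reindex[OF inj_on_part_fun]) simp
  finally show ?thesis
    by (simp add: J_rev_def cauchy_coeff_def sum_distrib_left sum_distrib_right)
qed

section \<open>The double product\<close>

lemma fps_dilate_prod: "fps_dilate c (\<Prod>x\<in>A. f x) = (\<Prod>x\<in>A. fps_dilate c (f x))"
proof (induction A rule: infinite_finite_induct)
  case (insert x A)
  then show ?case by (simp add: fps_dilate_mult)
qed (simp_all add: fps_dilate_def)

lemma fps_prod_nth_0: "fps_nth (\<Prod>x\<in>A. f x) 0 = (\<Prod>x\<in>A. fps_nth (f x :: 'a :: comm_ring_1 fps) 0)"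
  by (induction A rule: infinite_finite_induct) simp_all

definition geometric_fps :: "real \<Rightarrow> real fps" where
  "geometric_fps a = Abs_fps (\<lambda>n. a ^ n)"

lemma geometric_fps_inverse: "(1 - fps_const a * fps_X) * geometric_fps a = 1"
proof (rule fps_ext)
  fix n
  show "fps_nth ((1 - fps_const a * fps_X) * geometric_fps a) n = fps_nth 1 n"
    by (cases n) (simp_all add: geometric_fps_def left_diff_distrib mult.assoc)
qed

lemma inverse_eq_geometric_fps: "inverse (1 - fps_const a * fps_X) = geometric_fps a"
  by (rule fps_inverse_unique) (rule geometric_fps_inverse)

lemma fps_dilate_geometric: "fps_dilate c (geometric_fps a) = geometric_fps (c * a)"
  by (simp add: fps_eq_iff geometric_fps_def power_mult_distrib)

definition euler_trunc :: "real \<Rightarrow> nat \<Rightarrow> real fps" where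
  "euler_trunc t N = (\<Prod>s\<in>{0..N}. geometric_fps (t ^ s))"

lemma prod_trunc_eq: "prod_trunc (1 / t) N = (\<Prod>r\<in>{1..N}. fps_dilate (t ^ r) (euler_trunc t N))"
  unfolding prod_trunc_def euler_trunc_def fps_dilate_prod
  by (simp add: inverse_eq_geometric_fps fps_dilate_geometric power_add power_one_over)

text \<open>Dilation by \<open>t\<close> shifts \<open>s\<close> by one: the factor
  \<open>s = 0\<close> is lost and \<open>s = Suc N\<close> is gained. This is a finite form of
  \<open>euler_fps_dilate\<close>.\<close>

lemma euler_trunc_dilate:
  "(1 - fps_const (t ^ Suc N) * fps_X) * fps_dilate t (euler_trunc t N) = (1 - fps_X) * euler_trunc t N"
proof -
  have "euler_trunc t N * geometric_fps (t ^ Suc N) = (\<Prod>s\<in>{0..Suc N}. geometric_fps (t ^ s))"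
    by (simp add: euler_trunc_def)
  also have "\<dots> = geometric_fps 1 * fps_dilate t (euler_trunc t N)"
    unfolding euler_trunc_def fps_dilate_prod fps_dilate_geometric
    by (subst prod.atLeast0_atMost_Suc_shift) simp
  finally have "(1 - fps_X) * ((1 - fps_const (t ^ Suc N) * fps_X) * geometric_fps (t ^ Suc N)) * euler_trunc t N =
      (1 - fps_const (t ^ Suc N) * fps_X) * ((1 - fps_const 1 * fps_X) * geometric_fps 1) * fps_dilate t (euler_trunc t N)"
    by (simp add: mult_ac)
  then show ?thesis unfolding geometric_fps_inverse by simp
qed

lemma euler_trunc_tendsto:
  assumes t: "0 < t" "t < 1"
  shows "(\<lambda>N. fps_nth (euler_trunc t N) n) \<longlonglongrightarrow> 1 / qpoch t n"
proof (induction n)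
  case 0
  have "fps_nth (euler_trunc t N) 0 = 1" for N
    by (simp add: euler_trunc_def fps_prod_nth_0 geometric_fps_def)
  then show ?case by simp
next
  case (Suc n)
  have lt1: "t ^ Suc n < 1" using t by (intro power_Suc_less_one) auto
  have "fps_nth (euler_trunc t N) (Suc n) = (1 - t ^ Suc n * t ^ N) / (1 - t ^ Suc n) * fps_nth (euler_trunc t N) n" for N
  proof -
    have "fps_nth ((1 - fps_const (t ^ Suc N) * fps_X) * fps_dilate t (euler_trunc t N)) (Suc n) =
        fps_nth ((1 - fps_X) * euler_trunc t N) (Suc n)" by (simp only: euler_trunc_dilate)
    then have "t ^ Suc n * fps_nth (euler_trunc t N) (Suc n) - t ^ Suc N * (t ^ n * fps_nth (euler_trunc t N) n) =
        fps_nth (euler_trunc t N) (Suc n) - fps_nth (euler_trunc t N) n"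
      by (simp add: left_diff_distrib mult.assoc)
    then show ?thesis using lt1 by (simp add: field_simps)
  qed
  moreover have "(\<lambda>N. (1 - t ^ Suc n * t ^ N) / (1 - t ^ Suc n) * fps_nth (euler_trunc t N) n)
      \<longlonglongrightarrow> (1 - t ^ Suc n * 0) / (1 - t ^ Suc n) * (1 / qpoch t n)"
    by (intro tendsto_intros LIMSEQ_power_zero Suc) (use t lt1 in auto)
  ultimately show ?case by (simp add: qpoch_Suc mult.commute)
qed

text \<open>Both sides are the product over \<open>r\<close> from 1 to \<open>Suc N\<close>, with
  the last or the first factor split off. It is a finite form of
  \<open>A(t u) = E(t u) A(t^2 u)\<close>.\<close>

lemma prod_trunc_dilate:
  "prod_trunc (1 / t) N * fps_dilate (t ^ Suc N) (euler_trunc t N) =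
    fps_dilate t (euler_trunc t N * prod_trunc (1 / t) N)"
proof -
  have "prod_trunc (1 / t) N * fps_dilate (t ^ Suc N) (euler_trunc t N) =
      (\<Prod>r\<in>{1..Suc N}. fps_dilate (t ^ r) (euler_trunc t N))"
    unfolding prod_trunc_eq by (subst prod.nat_ivl_Suc') simp_all
  also have "\<dots> = fps_dilate t (euler_trunc t N) * (\<Prod>r\<in>{1..N}. fps_dilate (t ^ Suc r) (euler_trunc t N))"
    by (subst prod.atLeast_Suc_atMost) (simp_all add: prod.shift_bounds_cl_Suc_ivl del: prod.cl_ivl_Suc)
  also have "\<dots> = fps_dilate t (euler_trunc t N * prod_trunc (1 / t) N)"
    unfolding prod_trunc_eq fps_dilate_mult fps_dilate_prod fps_dilate_dilate by simp
  finally show ?thesis .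
qed

text \<open>The double product starts at \<open>r = 1\<close>, so its limit is
  \<open>A(t u)\<close>, whence \<open>t ^ n\<close>. Comparing coefficients in
  \<open>prod_trunc_dilate\<close> gives a recursion in \<open>n\<close> for each \<open>N\<close>,
  whose limit is that of \<open>cauchy_coeff_rec\<close>.\<close>

lemma prod_trunc_tendsto:
  assumes t: "0 < t" "t < 1"
  shows "(\<lambda>N. fps_nth (prod_trunc (1 / t) N) n) \<longlonglongrightarrow> t ^ n * cauchy_coeff t n"
proof (induction n rule: less_induct)
  case (less n)
  have gen: "generic t" using t by (simp add: generic_def)
  define b where "b N = fps_nth (prod_trunc (1 / t) N)" for N
  define e where "e N = fps_nth (euler_trunc t N)" for N
  show ?case
  proof (cases "n = 0")
    case True
    have "fps_nth (prod_trunc (1 / t) N) 0 = 1" for N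
      by (simp add: prod_trunc_eq euler_trunc_def fps_prod_nth_0 geometric_fps_def)
    then show ?thesis using True by (simp add: cauchy_coeff_0[OF gen])
  next
    case False
    have nz: "1 - t ^ n \<noteq> 0" using generic_power_neq_1[OF gen, of n] False by simp
    have e0: "e N 0 = 1" for N by (simp add: e_def euler_trunc_def fps_prod_nth_0 geometric_fps_def)
    have rec: "b N n = (\<Sum>i=1..n. (t ^ n - (t ^ N) ^ i * t ^ i) * (e N i * b N (n - i))) / (1 - t ^ n)" for N
    proof -
      have "fps_nth (fps_dilate (t ^ Suc N) (euler_trunc t N) * prod_trunc (1 / t) N) n =
          fps_nth (fps_dilate t (euler_trunc t N * prod_trunc (1 / t) N)) n"
        using prod_trunc_dilate[of t N] by (simp add: mult.commute)
      then have "(\<Sum>i=0..n. (t ^ Suc N) ^ i * (e N i * b N (n - i))) = t ^ n * (\<Sum>i=0..n. e N i * b N (n - i))"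
        by (simp add: fps_mult_nth e_def b_def mult.assoc)
      then have "b N n + (\<Sum>i=1..n. (t ^ Suc N) ^ i * (e N i * b N (n - i))) =
          t ^ n * (b N n + (\<Sum>i=1..n. e N i * b N (n - i)))"
        by (simp add: sum.atLeast_Suc_atMost e0)
      then have "(1 - t ^ n) * b N n = t ^ n * (\<Sum>i=1..n. e N i * b N (n - i))
          - (\<Sum>i=1..n. (t ^ Suc N) ^ i * (e N i * b N (n - i)))"
        by (simp add: algebra_simps)
      also have "\<dots> = (\<Sum>i=1..n. (t ^ n - (t ^ N) ^ i * t ^ i) * (e N i * b N (n - i)))"
        by (simp add: sum_distrib_left sum_subtractf[symmetric] algebra_simps power_mult_distrib)
      finally show ?thesis using nz by (simp add: field_simps)
    qed
    \<comment> \<open>The terms \<open>0 ^ i\<close> are the limits of \<open>(t ^ N) ^ i\<close>;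
      they vanish because the sum starts at \<open>i = 1\<close>.\<close>
    have "(\<lambda>N. b N n) \<longlonglongrightarrow> (\<Sum>i=1..n. (t ^ n - 0 ^ i * t ^ i) *
        (1 / qpoch t i * (t ^ (n - i) * cauchy_coeff t (n - i)))) / (1 - t ^ n)"
      unfolding rec
    proof (rule tendsto_divide[OF tendsto_sum tendsto_const nz])
      fix i assume i: "i \<in> {1..n}"
      have "(\<lambda>N. t ^ N) \<longlonglongrightarrow> 0" using t by (intro LIMSEQ_power_zero) auto
      moreover have "(\<lambda>N. e N i) \<longlonglongrightarrow> 1 / qpoch t i" unfolding e_def by (rule euler_trunc_tendsto[OF t])
      moreover have "(\<lambda>N. b N (n - i)) \<longlonglongrightarrow> t ^ (n - i) * cauchy_coeff t (n - i)"
        unfolding b_def using i by (intro less) auto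
      ultimately show "(\<lambda>N. (t ^ n - (t ^ N) ^ i * t ^ i) * (e N i * b N (n - i))) \<longlonglongrightarrow>
          (t ^ n - 0 ^ i * t ^ i) * (1 / qpoch t i * (t ^ (n - i) * cauchy_coeff t (n - i)))"
        by (intro tendsto_mult tendsto_diff tendsto_power tendsto_const)
    qed
    also have "(\<Sum>i=1..n. (t ^ n - 0 ^ i * t ^ i) * (1 / qpoch t i * (t ^ (n - i) * cauchy_coeff t (n - i)))) =
        t ^ n * (\<Sum>i=1..n. 1 / qpoch t i * (t ^ (n - i) * cauchy_coeff t (n - i)))"
      unfolding sum_distrib_left by (intro sum.cong) auto
    also have "(\<Sum>i=1..n. 1 / qpoch t i * (t ^ (n - i) * cauchy_coeff t (n - i))) = (1 - t ^ n) * cauchy_coeff t n"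
    proof -
      have "cauchy_coeff t n = t ^ n * cauchy_coeff t n
          + (\<Sum>i=1..n. 1 / qpoch t i * (t ^ (n - i) * cauchy_coeff t (n - i)))"
        by (subst cauchy_coeff_rec[OF gen]) (simp add: atMost_atLeast0 sum.atLeast_Suc_atMost)
      then show ?thesis by (simp add: algebra_simps)
    qed
    finally show ?thesis using nz by (simp add: b_def)
  qed
qed

text \<open>The symmetry is the polynomial identity
  \<open>X^(degree p) p = X^d (reflect_poly p)\<close>, valid at all nonzero points. With a nonzero
  constant coefficient, reflection preserves the degree, so comparing degrees gives
  \<open>d\<close>.\<close>

lemma degree_palindromic:
  fixes p :: "real poly"
  assumes pal: "\<And>q. q \<noteq> 0 \<Longrightarrow> poly p q = q ^ d * poly p (1 / q)" and p0: "poly p 0 \<noteq> 0"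
  shows "degree p = d"
proof -
  have c0: "coeff p 0 \<noteq> 0" using p0 by (simp add: poly_0_coeff_0)
  then have pnz: "p \<noteq> 0" by auto
  let ?D = "monom 1 (degree p) * p - monom 1 d * reflect_poly p"
  have "poly ?D q = 0" if "q \<noteq> 0" for q
    using pal[OF that] poly_reflect_poly_nz[of q p] that by (simp add: poly_monom inverse_eq_divide)
  then have "- {0} \<subseteq> {q. poly ?D q = 0}" by auto
  moreover have "infinite (- {0 :: real})" by (simp add: infinite_UNIV_char_0 finite_compl)
  ultimately have "?D = 0" using poly_roots_finite[of ?D] finite_subset by blast
  then have "monom 1 (degree p) * p = monom 1 d * reflect_poly p" by simp
  then have "degree (monom 1 (degree p) * p) = degree (monom 1 d * reflect_poly p)" by simp
  then show ?thesis
    using pnz c0 by (simp add: degree_mult_eq degree_monom_eq reflect_poly_eq_0_iff)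
qed

theorem theorem6:
  fixes n :: nat
  shows "(\<exists>p :: int poly.
            degree p = 2 * (n choose 2)
          \<and> (\<forall>i. coeff p i \<ge> 0)
          \<and> (\<forall>q::real. q \<noteq> 0 \<and> q \<noteq> 1 \<and> q \<noteq> -1 \<longrightarrow> J_n n q = poly (map_poly of_int p) q)
          \<and> (\<forall>q::real. q \<noteq> 0 \<longrightarrow>
               poly (map_poly of_int p) q = q ^ (2 * (n choose 2)) * poly (map_poly of_int p) (1 / q))
          \<and> poly (map_poly of_int p) (1::real) = fact n)
       \<and> (\<forall>q::real. q > 1 \<longrightarrow>
            (\<lambda>N. fps_nth (prod_trunc q N) n)
              \<longlonglongrightarrow> J_n n q / (q ^ (n ^ 2) * (\<Prod>k\<in>{1..n}. (1 - 1 / q ^ k) ^ 2)))"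
proof (intro conjI allI impI)
  have ev: "even (n * (n - 1))" by (cases n) auto
  then have choose: "2 * (n choose 2) = n * (n - 1)" by (simp only: choose_two dvd_mult_div_cancel)
  have m1: "(- 1 :: real) ^ (n * (n - 1)) = 1" using ev by (simp only: neg_one_even_power)
  obtain p :: "nat \<Rightarrow> int poly" where p: "\<And>m i. coeff (p m) i \<ge> 0"
    "\<And>m t. generic t \<Longrightarrow> J_rev m t = poly (map_poly of_int (p m)) t"
    using nonneg_int_poly_fun_J_rev unfolding nonneg_int_poly_fun_def by metis
  let ?P = "map_poly of_int (p n) :: real poly"
  \<comment> \<open>Palindromicity lets the polynomial found for \<open>J_rev\<close> serve for
    \<open>J_n\<close> unreversed.\<close>
  have J: "J_n n q = poly ?P q" if "generic q" for q
    using J_n_eq[OF that] J_rev_palindromic[OF that] p(2)[OF that] by simp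
  have pal: "poly ?P q = q ^ (n * (n - 1)) * poly ?P (1 / q)" if "q \<noteq> 0" for q
  proof (cases "generic q")
    case True
    then show ?thesis
      using J_rev_palindromic[OF True] p(2)[OF True] p(2)[OF generic_inverse[OF True]] by simp
  next
    case False
    \<comment> \<open>Here \<open>1 / q = q\<close>, and the exponent \<open>n * (n - 1)\<close> is
      even.\<close>
    then have "q = 1 \<or> q = - 1" using that by (auto simp: generic_def)
    then show ?thesis using m1 by auto
  qed
  note special = J_rev_poly_values[where P = "\<lambda>m. map_poly of_int (p m)", OF p(2)]
  have "degree ?P = n * (n - 1)"
    by (rule degree_palindromic[OF pal]) (use special(1) in auto)
  moreover have "degree ?P = degree (p n)" by (rule degree_map_poly) auto
  ultimately show "\<exists>p :: int poly.
            degree p = 2 * (n choose 2)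
          \<and> (\<forall>i. coeff p i \<ge> 0)
          \<and> (\<forall>q::real. q \<noteq> 0 \<and> q \<noteq> 1 \<and> q \<noteq> -1 \<longrightarrow> J_n n q = poly (map_poly of_int p) q)
          \<and> (\<forall>q::real. q \<noteq> 0 \<longrightarrow>
               poly (map_poly of_int p) q = q ^ (2 * (n choose 2)) * poly (map_poly of_int p) (1 / q))
          \<and> poly (map_poly of_int p) (1::real) = fact n"
    unfolding choose
  proof (intro exI[of _ "p n"] conjI allI impI)
    show "J_n n q = poly ?P q" if "q \<noteq> 0 \<and> q \<noteq> 1 \<and> q \<noteq> - 1" for q
      using that by (intro J) (auto simp: generic_def)
    show "poly ?P q = q ^ (n * (n - 1)) * poly ?P (1 / q)" if "q \<noteq> 0" for q
      using that by (rule pal)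
    show "poly ?P 1 = fact n" by (rule special(2))
  qed (use p(1) in simp_all)
next
  fix q :: real assume q: "q > 1"
  define t where "t = 1 / q"
  have t: "0 < t" "t < 1" using q by (auto simp: t_def)
  have gen: "generic q" "generic t" using q t by (auto simp: generic_def)
  have prod: "(\<Prod>k\<in>{1..n}. (1 - 1 / q ^ k) ^ 2) = (qpoch t n)\<^sup>2"
    by (simp add: qpoch_def t_def power_one_over prod_power_distrib)
  \<comment> \<open>The part \<open>n * (n - 1)\<close> cancels the prefactor of \<open>J_n\<close>,
    and the rest supplies the \<open>t ^ n\<close> of the limit.\<close>
  have "n ^ 2 = n * (n - 1) + n" by (cases n) (auto simp: power2_eq_square)
  then have "q ^ (n ^ 2) = q ^ (n * (n - 1)) * q ^ n" by (simp only: power_add)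
  then have "J_n n q / (q ^ (n ^ 2) * (\<Prod>k\<in>{1..n}. (1 - 1 / q ^ k) ^ 2)) = t ^ n * cauchy_coeff t n"
    unfolding prod J_n_eq[OF gen(1)] J_rev_def t_def[symmetric]
    using qpoch_nonzero[OF gen(2), of n] q by (simp add: t_def power_one_over)
  then show "(\<lambda>N. fps_nth (prod_trunc q N) n)
      \<longlonglongrightarrow> J_n n q / (q ^ (n ^ 2) * (\<Prod>k\<in>{1..n}. (1 - 1 / q ^ k) ^ 2))"
    using prod_trunc_tendsto[OF t, of n] by (simp add: t_def)
qed

end
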